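(* Let $q\in(-1,1)$, $0<|\rho|<1$ and $x,y\in\left[-\frac{2}{\sqrt{1-q}},\frac{2}{\sqrt{1-q}}\right]$. Then $$f_{CN}(x|y,\rho,q)=f_K(x|y,\rho,q)\left(1+\sum_{n=2}^{\infty}\beta_n(y,\rho,q)\,k_n\!\left(x\sqrt{1-q}\,\big|\,y\sqrt{1-q},\rho\right)\right),$$ where, for $n\ge 2$, $$\beta_n(y,\rho,q)=\sum_{j=1}^{\lfloor n/2\rfloor}(-1)^j(1-q)^{n/2-j}q^{n+j(j-3)/2}\begin{bmatrix} n-1-j\\ n-2j\end{bmatrix}_q\rho^{n-2j}H_{n-2j}(y|q).$$
   Context: Notation: $[0]_q=0$, $[n]_q=1+q+\dots+q^{n-1}$, $[n]_q!=\prod_{i=1}^n[i]_q$, $[0]_q!=1$, $\begin{bmatrix} n\\ k\end{bmatrix}_q=\frac{[n]_q!}{[n-k]_q![k]_q!}$ if $n\ge k\ge0$ and $0$ otherwise; $(a)_\infty=\prod_{i\ge0}(1-aq^i)$; $0^0=1$. The densities are $$f_{CN}(x|y,\rho,q)=\frac{\sqrt{1-q}\,(\rho^2)_\infty(q)_\infty}{2\pi\sqrt{4-(1-q)x^2}}\prod_{k=0}^\infty\frac{(1+q^k)^2-(1-q)x^2q^k}{(1-\rho^2q^{2k})^2-(1-q)\rho q^k(1+\rho^2q^{2k})xy+(1-q)\rho^2(x^2+y^2)q^{2k}}$$ (at the endpoints $x=\pm2/\sqrt{1-q}$ understood by continuity, i.e. equal to $0$, since the $k=0$ numerator factor is $4-(1-q)x^2$),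 and $$f_K(x|y,\rho,q)=\frac{(1-\rho^2)\sqrt{1-q}\,\sqrt{4-(1-q)x^2}}{2\pi\left((1-\rho^2)^2-\rho(1-q)(1+\rho^2)xy+(1-q)\rho^2(x^2+y^2)\right)}$$ for $|x|\le 2/\sqrt{1-q}$. $q$-Hermite polynomials: $H_{-1}(x|q)=0$, $H_0(x|q)=1$, $H_{n+1}(x|q)=xH_n(x|q)-[n]_qH_{n-1}(x|q)$. $k_n(x|y,\rho)=U_n(x/2)-\rho yU_{n-1}(x/2)+\rho^2U_{n-2}(x/2)$ for $n\ge2$, where $U_n$ are the Chebyshev polynomials of the second kind ($U_{-1}=0$, $U_0=1$, $2xU_n(x)=U_{n+1}(x)+U_{n-1}(x)$). *)

theory Defs
  imports "HOL-Analysis.Analysis"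
begin

definition q_int :: "real \<Rightarrow> nat \<Rightarrow> real" where
  "q_int q n = (\<Sum>i<n. q ^ i)"

definition q_fact :: "real \<Rightarrow> nat \<Rightarrow> real" where
  "q_fact q n = (\<Prod>i=1..n. q_int q i)"

definition q_binom :: "real \<Rightarrow> nat \<Rightarrow> nat \<Rightarrow> real" where
  "q_binom q n k = (if k \<le> n then q_fact q n / (q_fact q (n - k) * q_fact q k) else 0)"

definition q_poch_inf :: "real \<Rightarrow> real \<Rightarrow> real" where
  "q_poch_inf a q = (\<Prod>i. 1 - a * q ^ i)"

(* Starting from H_0 = 1 and H_1 = x is the recursion with the convention H_{-1} = 0;
   likewise for U_{-1} = 0 below. *)
fun q_hermite :: "nat \<Rightarrow> real \<Rightarrow> real \<Rightarrow> real" where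
  "q_hermite 0 x q = 1"
| "q_hermite (Suc 0) x q = x"
| "q_hermite (Suc (Suc n)) x q =
     x * q_hermite (Suc n) x q - q_int q (Suc n) * q_hermite n x q"

fun cheb_U :: "nat \<Rightarrow> real \<Rightarrow> real" where
  "cheb_U 0 x = 1"
| "cheb_U (Suc 0) x = 2 * x"
| "cheb_U (Suc (Suc n)) x = 2 * x * cheb_U (Suc n) x - cheb_U n x"

(* Only meant for n >= 2, since subtraction on nat truncates. *)
definition k_poly :: "nat \<Rightarrow> real \<Rightarrow> real \<Rightarrow> real \<Rightarrow> real" where
  "k_poly n x y \<rho> =
     cheb_U n (x / 2) - \<rho> * y * cheb_U (n - 1) (x / 2) + \<rho>\<^sup>2 * cheb_U (n - 2) (x / 2)"

(* At the endpoints (1 - q) * x^2 = 4 this is 0, the value by continuity: the factor k = 0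
   of the product vanishes (and the division by sqrt 0 yields 0). *)
definition f_CN :: "real \<Rightarrow> real \<Rightarrow> real \<Rightarrow> real \<Rightarrow> real" where
  "f_CN x y \<rho> q =
     sqrt (1 - q) * q_poch_inf (\<rho>\<^sup>2) q * q_poch_inf q q / (2 * pi * sqrt (4 - (1 - q) * x\<^sup>2)) *
     (\<Prod>k. ((1 + q ^ k)\<^sup>2 - (1 - q) * x\<^sup>2 * q ^ k) /
        ((1 - \<rho>\<^sup>2 * q ^ (2 * k))\<^sup>2
          - (1 - q) * \<rho> * q ^ k * (1 + \<rho>\<^sup>2 * q ^ (2 * k)) * x * y
          + (1 - q) * \<rho>\<^sup>2 * (x\<^sup>2 + y\<^sup>2) * q ^ (2 * k)))"

definition f_K :: "real \<Rightarrow> real \<Rightarrow> real \<Rightarrow> real \<Rightarrow> real" where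
  "f_K x y \<rho> q =
     (1 - \<rho>\<^sup>2) * sqrt (1 - q) * sqrt (4 - (1 - q) * x\<^sup>2) /
     (2 * pi * ((1 - \<rho>\<^sup>2)\<^sup>2 - \<rho> * (1 - q) * (1 + \<rho>\<^sup>2) * x * y
        + (1 - q) * \<rho>\<^sup>2 * (x\<^sup>2 + y\<^sup>2)))"

(* The exponent of q is an int because j * (j - 3) div 2 = -1 for j = 1, 2; the division by 2
   is exact, and the total exponent is positive for 1 <= j <= n div 2. *)
definition beta_coeff :: "nat \<Rightarrow> real \<Rightarrow> real \<Rightarrow> real \<Rightarrow> real" where
  "beta_coeff n y \<rho> q =
     (\<Sum>j=1..n div 2. (-1) ^ j * (1 - q) powr (real n / 2 - real j)
        * q powi (int n + (int j * (int j - 3)) div 2)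
        * q_binom q (n - 1 - j) (n - 2 * j)
        * \<rho> ^ (n - 2 * j) * q_hermite (n - 2 * j) y q)"

end

(* Put X = x sqrt(1-q), Y = y sqrt(1-q) and let h_n be the q-Hermite polynomials rescaled to these
   variables. The series Theta_n(X) = sum_j (-1)^j q^(j(j+1)/2) [n+j, j]_q U_(n+2j)(X/2) obeys the
   three-term recurrence of h_n(X)/(q)_n, so Theta_n = h_n Theta_0/(q)_n, and a finite form of the
   Jacobi triple product identifies Theta_0 with the theta product in the numerator of f_CN. In the
   same way the Poisson-Mehler kernel sum_n r^n h_n(X) h_n(Y)/(q)_n satisfies a first order q-difference
   equation in r, which produces the denominators. Hence f_CN, divided by its semicircle factor, equals
   sum_n rho^n h_n(Y) Theta_n(X), which regrouped by the index of U reads sum_m c_m U_m.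
   Finally the polynomials k_m satisfy k_m - rho Y k_(m+1) + rho^2 k_(m+2) = W U_m, W being the
   denominator of f_K, and summation by parts moves this operator onto c_m, where it produces
   (1 - rho^2) beta_m. *)
theory Submission
  imports Defs
begin

section \<open>Finite q-products and the theta series\<close>

text \<open>Convergence fixes the order of the proof. The double series below need h_n(X) and h_n(Y)
  to grow slowly on all of [-2, 2], also for negative q, a bound that the recurrence of h_n does not
  display. The theta series supplies it: Theta_n is O(n) because |U_m| <= m + 1, and Theta_0 is
  nonzero because its product starts at k = 1, so h_n = (q)_n Theta_n / Theta_0 is O(n) as well.
  Hence the triple product comes before the Poisson-Mehler kernel. The numerator factor k = 0, which
  is 4 - X^2, is kept apart: with the square root in the denominator it forms the semicircle factor,
  and it is the only one that vanishes at the endpoints. The algebra stays in X and the Chebyshev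
  polynomials, so that nothing is divided by a sine. The summand 1 next to the series is the
  boundary term of the summation by parts. Continued backwards, k_0 = 1 - rho^2 and k_1 = X - rho Y;
  since c_0 = 1 and c_1 = rho Y, the k_1 terms cancel and c_0 k_0 = 1 - rho^2 remains.\<close>

definition q_poch :: "real \<Rightarrow> nat \<Rightarrow> real" where
  "q_poch q n = (\<Prod>i=1..n. 1 - q ^ i)"

text \<open>The Gaussian binomial [n+j, j]_q, indexed by its two lower parts so that no subtraction
  of naturals occurs. Using (q)_n in place of [n]_q! removes all powers of 1 - q.\<close>

definition gauss :: "real \<Rightarrow> nat \<Rightarrow> nat \<Rightarrow> real" where
  "gauss q n j = q_poch q (n + j) / (q_poch q n * q_poch q j)"

text \<open>This is (-1)^j q^(j(j+1)/2); the product form gives the recursion in j at once and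
  avoids halving the exponent.\<close>

definition theta_coeff :: "real \<Rightarrow> nat \<Rightarrow> real" where
  "theta_coeff q j = (\<Prod>i=1..j. - (q ^ i))"

fun herm :: "real \<Rightarrow> nat \<Rightarrow> real \<Rightarrow> real" where
  "herm q 0 X = 1"
| "herm q (Suc 0) X = X"
| "herm q (Suc (Suc n)) X = X * herm q (Suc n) X - (1 - q ^ Suc n) * herm q n X"

definition U :: "nat \<Rightarrow> real \<Rightarrow> real" where
  "U m X = cheb_U m (X / 2)"

definition theta_U :: "real \<Rightarrow> nat \<Rightarrow> real \<Rightarrow> real" where
  "theta_U q n X = (\<Sum>j. theta_coeff q j * gauss q n j * U (n + 2 * j) X)"

lemma U_simps [simp]:
  "U 0 X = 1" "U (Suc 0) X = X" "U (Suc (Suc n)) X = X * U (Suc n) X - U n X"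
  by (simp_all add: U_def)

lemma theta_coeff_0 [simp]: "theta_coeff q 0 = 1"
  and theta_coeff_Suc: "theta_coeff q (Suc j) = - (q ^ Suc j * theta_coeff q j)"
  by (simp_all add: theta_coeff_def)

lemma q_poch_0 [simp]: "q_poch q 0 = 1"
  and q_poch_Suc: "q_poch q (Suc n) = q_poch q n * (1 - q ^ Suc n)"
  by (simp_all add: q_poch_def)

lemma abs_power_Suc_less_one:
  fixes q :: real
  assumes "\<bar>q\<bar> < 1"
  shows "\<bar>q ^ Suc n\<bar> < 1"
  unfolding power_abs using assms by (metis abs_ge_zero power_less_one_iff zero_less_Suc)

lemma one_minus_power_pos:
  fixes q :: real
  assumes "\<bar>q\<bar> < 1"
  shows "1 - q ^ Suc n > 0"
  using abs_power_Suc_less_one[OF assms, of n] by linarith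

lemma q_poch_pos: "\<bar>q\<bar> < 1 \<Longrightarrow> q_poch q n > 0"
proof (induction n)
  case (Suc n)
  then show ?case
    unfolding q_poch_Suc by (intro mult_pos_pos one_minus_power_pos) auto
qed simp

text \<open>With X = 2 cos t, the formula sin t U_m = sin((m+1) t) cannot be divided by sin t at X =
  2 or X = -2. The bound comes instead from \<open>C\<close>, where each step adds at most
  1.\<close>

lemma U_abs_le:
  assumes "\<bar>X\<bar> \<le> 2"
  shows "\<bar>U m X\<bar> \<le> real m + 1"
proof -
  define t where "t = arccos (X / 2)"
  have X: "X = 2 * cos t"
    using assms by (simp add: t_def)
  have S: "sin t * U m X = sin (real (Suc m) * t)" for m
  proof (induction m rule: induct_nat_012)
    case 0
    then show ?case by simp
  next
    case 1
    then show ?case by (simp add: X sin_double)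
  next
    case (ge2 n)
    have "sin t * U (Suc (Suc n)) X = 2 * cos t * sin (real (Suc (Suc n)) * t) - sin (real (Suc n) * t)"
      using ge2 by (simp add: X algebra_simps)
    also have "\<dots> = sin (real (Suc (Suc n)) * t + t)"
    proof -
      have "real (Suc n) * t = real (Suc (Suc n)) * t - t" by (simp add: algebra_simps)
      then show ?thesis by (simp only: sin_add sin_diff) (simp add: algebra_simps)
    qed
    finally show ?case by (simp add: algebra_simps)
  qed
  have C: "U (Suc m) X = cos t * U m X + cos (real (Suc m) * t)" for m
  proof (induction m)
    case 0
    then show ?case by (simp add: X)
  next
    case (Suc m)
    have "U (Suc (Suc m)) X = cos t * U (Suc m) X + (cos t * (cos t * U m X + cos (real (Suc m) * t)) - U m X)"
      using Suc by (simp add: X algebra_simps)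
    \<comment> \<open>Here (cos^2 t - 1) U_m becomes - sin t (sin t U_m), so that \<open>S\<close>
      applies without a division.\<close>
    also have "cos t * (cos t * U m X + cos (real (Suc m) * t)) - U m X
       = cos t * cos (real (Suc m) * t) - sin t * (sin t * U m X)"
      using sin_cos_squared_add[of t] by algebra
    also have "\<dots> = cos (real (Suc m) * t + t)"
      by (simp only: S cos_add) simp
    finally show ?case by (simp add: algebra_simps)
  qed
  show ?thesis
  proof (induction m)
    case (Suc m)
    have "\<bar>cos t * U m X\<bar> \<le> 1 * \<bar>U m X\<bar>"
      unfolding abs_mult by (intro mult_right_mono) auto
    moreover have "\<bar>cos (real (Suc m) * t)\<bar> \<le> 1" by simp
    ultimately show ?case
      using Suc C[of m] by linarith
  qed simp
qed

lemma U_Suc_abs_le: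
  assumes "\<bar>X\<bar> \<le> 2"
  shows "\<bar>U (Suc m) X\<bar> \<le> 2 * (real m + 1)"
  using U_abs_le[OF assms, of "Suc m"] by simp

lemma theta_coeff_abs_le:
  assumes "\<bar>q\<bar> < 1"
  shows "\<bar>theta_coeff q j\<bar> \<le> \<bar>q\<bar> ^ j"
proof (induction j)
  case (Suc j)
  have "\<bar>q ^ Suc j\<bar> \<le> \<bar>q\<bar>"
    using assms by (simp add: abs_mult power_abs mult_left_le power_le_one)
  with Suc show ?case
    by (simp add: theta_coeff_Suc abs_mult del: power_Suc) (simp add: mult_mono)
qed simp

section \<open>Infinite products and uniform bounds for (q)_n\<close>

lemma convergent_prod_geometric:
  fixes f :: "nat \<Rightarrow> real"
  assumes "\<bar>q\<bar> < 1" and "\<And>k. \<bar>f k - 1\<bar> \<le> C * \<bar>q\<bar> ^ k"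
  shows "convergent_prod f"
proof -
  have "summable (\<lambda>k. C * \<bar>q\<bar> ^ k)"
    using assms by (intro summable_mult summable_geometric) auto
  then have "summable (\<lambda>k. norm (f k - 1))"
    by (rule summable_comparison_test[rotated]) (use assms in auto)
  then show ?thesis
    by (intro abs_convergent_prod_imp_convergent_prod) (simp add: abs_convergent_prod_conv_summable)
qed

lemma prod_lessThan_LIMSEQ:
  fixes f :: "nat \<Rightarrow> real"
  assumes "convergent_prod f"
  shows "(\<lambda>n. \<Prod>i<n. f i) \<longlonglongrightarrow> prodinf f"
  using convergent_prod_LIMSEQ[OF assms]
  by (subst filterlim_sequentially_Suc[symmetric]) (simp add: lessThan_Suc_atMost)

lemma convergent_prod_q_poch:
  fixes a q :: real
  assumes "\<bar>q\<bar> < 1"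
  shows "convergent_prod (\<lambda>i. 1 - a * q ^ i)"
  by (rule convergent_prod_geometric[OF assms, of _ "\<bar>a\<bar>"]) (simp add: abs_mult power_abs)

lemma q_poch_LIMSEQ:
  assumes "\<bar>q\<bar> < 1"
  shows "q_poch q \<longlonglongrightarrow> q_poch_inf q q"
proof -
  have "q_poch q = (\<lambda>n. \<Prod>i<n. 1 - q * q ^ i)"
    by (simp add: q_poch_def fun_eq_iff prod.atLeast1_atMost_eq)
  then show ?thesis
    using prod_lessThan_LIMSEQ[OF convergent_prod_q_poch[OF assms, of q]] by (simp add: q_poch_inf_def)
qed

lemma q_poch_inf_nonzero:
  assumes "\<bar>q\<bar> < 1"
  shows "q_poch_inf q q \<noteq> 0"
  unfolding q_poch_inf_def
  using one_minus_power_pos[OF assms]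
  by (intro prodinf_nonzero convergent_prod_q_poch assms) (metis less_irrefl power_Suc)

text \<open>For negative q the factors 1 - q^i alternate around 1, so (q)_n is not monotone; both
  bounds come from convergence to a nonzero limit.\<close>

lemma q_poch_bounded:
  assumes "\<bar>q\<bar> < 1"
  obtains K where "K > 0" "\<And>n. q_poch q n \<le> K" "\<And>n. inverse (q_poch q n) \<le> K"
proof -
  have "Bseq (q_poch q)" "Bseq (\<lambda>n. inverse (q_poch q n))"
    using q_poch_LIMSEQ[OF assms] tendsto_inverse[OF q_poch_LIMSEQ[OF assms] q_poch_inf_nonzero[OF assms]]
    by (auto intro!: convergent_imp_Bseq simp: convergent_def)
  then obtain K1 K2 where K: "K1 > 0" "\<And>n. norm (q_poch q n) \<le> K1" "\<And>n. norm (inverse (q_poch q n)) \<le> K2"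
    by (auto simp: Bseq_def)
  show ?thesis
  proof (rule that[of "max K1 K2"])
    show "q_poch q n \<le> max K1 K2" for n using K(2)[of n] by auto
    show "inverse (q_poch q n) \<le> max K1 K2" for n using K(3)[of n] unfolding real_norm_def by linarith
  qed (use K in auto)
qed

lemma gauss_bounded:
  assumes "\<bar>q\<bar> < 1"
  obtains K where "K > 0" "\<And>n j. \<bar>gauss q n j\<bar> \<le> K"
proof -
  obtain K where K: "K > 0" "\<And>n. q_poch q n \<le> K" "\<And>n. inverse (q_poch q n) \<le> K"
    using q_poch_bounded[OF assms] by metis
  show ?thesis
  proof (rule that[of "K * (K * K)"])
    fix n j
    have "\<bar>gauss q n j\<bar> = q_poch q (n + j) * (inverse (q_poch q n) * inverse (q_poch q j))"
      using q_poch_pos[OF assms] by (simp add: gauss_def divide_inverse less_imp_le abs_mult)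
    also have "\<dots> \<le> K * (K * K)"
      using K q_poch_pos[OF assms] by (intro mult_mono) (auto simp: less_imp_le)
    finally show "\<bar>gauss q n j\<bar> \<le> K * (K * K)" .
  qed (use K in simp)
qed

lemma gauss_0 [simp]:
  assumes "\<bar>q\<bar> < 1"
  shows "gauss q n 0 = 1" "gauss q 0 j = 1"
  using q_poch_pos[OF assms, of n] q_poch_pos[OF assms, of j] by (auto simp: gauss_def)

text \<open>One of the two q-Pascal rules; the other follows from it through
  \<open>gauss_sym\<close>.\<close>

lemma gauss_pascal:
  assumes "\<bar>q\<bar> < 1"
  shows "gauss q (Suc n) (Suc j) - gauss q n (Suc j) = q ^ Suc n * gauss q (Suc n) j"
proof -
  define a b s t P where "a = q_poch q n" and "b = q_poch q j" and "s = q ^ Suc n" and "t = q ^ Suc j"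
    and "P = q_poch q (Suc (n + j))"
  have nz: "a \<noteq> 0" "b \<noteq> 0" "1 - s \<noteq> 0" "1 - t \<noteq> 0"
    using q_poch_pos[OF assms, of n] q_poch_pos[OF assms, of j] one_minus_power_pos[OF assms, of n]
      one_minus_power_pos[OF assms, of j] by (auto simp: a_def b_def s_def t_def)
  have "q ^ Suc (Suc (n + j)) = s * t"
    by (simp add: s_def t_def power_add)
  then have "gauss q (Suc n) (Suc j) = P * (1 - s * t) / (a * (1 - s) * (b * (1 - t)))"
    by (simp only: gauss_def add_Suc add_Suc_right q_poch_Suc[of q "Suc (n + j)"] q_poch_Suc[of q n]
        q_poch_Suc[of q j] a_def b_def s_def t_def P_def)
  moreover have "gauss q n (Suc j) = P / (a * (b * (1 - t)))"
    by (simp only: gauss_def add_Suc add_Suc_right q_poch_Suc[of q j] a_def b_def t_def P_def)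
  moreover have "gauss q (Suc n) j = P / (a * (1 - s) * b)"
    by (simp only: gauss_def add_Suc add_Suc_right q_poch_Suc[of q n] a_def b_def s_def P_def)
  moreover have "P * (1 - s * t) / (a * (1 - s) * (b * (1 - t))) - P / (a * (b * (1 - t)))
      = s * (P / (a * (1 - s) * b))"
  proof -
    have "P / (a * (b * (1 - t))) = P * (1 - s) / (a * (1 - s) * (b * (1 - t)))"
      using nz by simp
    moreover have "P / (a * (1 - s) * b) = P * (1 - t) / (a * (1 - s) * (b * (1 - t)))"
      using nz by simp
    moreover have "P * (1 - s * t) - P * (1 - s) = s * (P * (1 - t))"
      by algebra
    ultimately show ?thesis
      by (simp only: diff_divide_distrib[symmetric] times_divide_eq_right)
  qed
  ultimately show ?thesis by (simp only: s_def)
qed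

lemma gauss_absorb:
  assumes "\<bar>q\<bar> < 1"
  shows "(1 - q ^ Suc n) * gauss q (Suc n) j = (1 - q ^ Suc (n + j)) * gauss q n j"
  using one_minus_power_pos[OF assms, of n]
  unfolding gauss_def add_Suc q_poch_Suc by (simp del: power_Suc)

section \<open>Absolute convergence of the theta series\<close>

lemma summable_Suc_power:
  fixes q :: real
  assumes "\<bar>q\<bar> < 1"
  shows "summable (\<lambda>j. real (Suc j) * \<bar>q\<bar> ^ j)"
  using geometric_deriv_sums[of "\<bar>q\<bar>"] assms by (auto simp: sums_iff)

text \<open>The sequence v is arbitrary because the bound serves the Chebyshev polynomials, their
  index shift and later the polynomials k. By n + 2j + 1 <= 2 (n+1)(j+1) the dependence on n and j
  separates, so that a double series can be compared with a product of two single ones.\<close>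

lemma theta_U_term_bound:
  assumes "\<bar>q\<bar> < 1"
  obtains K where "K > 0"
    "\<And>v c n j. (\<And>m. \<bar>v m\<bar> \<le> c * (real m + 1)) \<Longrightarrow>
       \<bar>theta_coeff q j * gauss q n j * v (n + 2 * j)\<bar> \<le> c * K * (real n + 1) * (real (Suc j) * \<bar>q\<bar> ^ j)"
proof -
  obtain K where K: "K > 0" "\<And>n j. \<bar>gauss q n j\<bar> \<le> K"
    using gauss_bounded[OF assms] by metis
  show ?thesis
  proof (rule that[of "2 * K"])
    fix v :: "nat \<Rightarrow> real" and c :: real and n j
    assume v: "\<And>m. \<bar>v m\<bar> \<le> c * (real m + 1)"
    have c: "c \<ge> 0" using v[of 0] by simp
    have "\<bar>v (n + 2 * j)\<bar> \<le> c * (real (n + 2 * j) + 1)" by (rule v)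
    also have "\<dots> \<le> c * (2 * (real n + 1) * real (Suc j))"
      by (intro mult_left_mono c) (simp add: algebra_simps)
    finally have "\<bar>v (n + 2 * j)\<bar> \<le> c * (2 * (real n + 1) * real (Suc j))" .
    then have "\<bar>theta_coeff q j\<bar> * \<bar>gauss q n j\<bar> * \<bar>v (n + 2 * j)\<bar>
        \<le> \<bar>q\<bar> ^ j * K * (c * (2 * (real n + 1) * real (Suc j)))"
      using K c by (intro mult_mono theta_coeff_abs_le assms) auto
    then show "\<bar>theta_coeff q j * gauss q n j * v (n + 2 * j)\<bar>
        \<le> c * (2 * K) * (real n + 1) * (real (Suc j) * \<bar>q\<bar> ^ j)"
      by (simp add: abs_mult mult_ac)
  qed (use K in auto)
qed

lemma summable_theta_U_term:
  assumes "\<bar>q\<bar> < 1" and "\<And>m. \<bar>v m\<bar> \<le> c * (real m + 1)"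
  shows "summable (\<lambda>j. \<bar>theta_coeff q j * gauss q n j * v (n + 2 * j)\<bar>)"
proof -
  obtain K where K: "\<And>v c n j. (\<And>m. \<bar>v m\<bar> \<le> c * (real m + 1)) \<Longrightarrow>
       \<bar>theta_coeff q j * gauss q n j * v (n + 2 * j)\<bar> \<le> c * K * (real n + 1) * (real (Suc j) * \<bar>q\<bar> ^ j)"
    using theta_U_term_bound[OF assms(1)] by metis
  have "summable (\<lambda>j. c * K * (real n + 1) * (real (Suc j) * \<bar>q\<bar> ^ j))"
    by (intro summable_mult summable_Suc_power assms)
  then show ?thesis
    by (rule summable_comparison_test[rotated]) (use K[of v c] assms(2) in auto)
qed

lemma theta_U_sums:
  assumes "\<bar>q\<bar> < 1" "\<bar>X\<bar> \<le> 2"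
  shows "(\<lambda>j. theta_coeff q j * gauss q n j * U (n + 2 * j) X) sums theta_U q n X"
  unfolding theta_U_def
  by (rule summable_sums, rule summable_rabs_cancel,
      rule summable_theta_U_term[OF assms(1), where v = "\<lambda>m. U m X" and c = 1])
     (use U_abs_le[OF assms(2)] in simp)

lemma theta_U_abs_le:
  assumes "\<bar>q\<bar> < 1"
  obtains K where "K > 0" "\<And>n X. \<bar>X\<bar> \<le> 2 \<Longrightarrow> \<bar>theta_U q n X\<bar> \<le> K * (real n + 1)"
proof -
  obtain K where K: "K > 0" "\<And>v c n j. (\<And>m. \<bar>v m\<bar> \<le> c * (real m + 1)) \<Longrightarrow>
       \<bar>theta_coeff q j * gauss q n j * v (n + 2 * j)\<bar> \<le> c * K * (real n + 1) * (real (Suc j) * \<bar>q\<bar> ^ j)"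
    using theta_U_term_bound[OF assms(1)] by metis
  define S where "S = (\<Sum>j. real (Suc j) * \<bar>q\<bar> ^ j)"
  have S: "S > 0"
    unfolding S_def
    by (rule suminf_pos2[OF summable_Suc_power[OF assms], of 0]) auto
  show ?thesis
  proof (rule that[of "K * S"])
    fix n and X :: real assume X: "\<bar>X\<bar> \<le> 2"
    have U: "\<bar>U m X\<bar> \<le> 1 * (real m + 1)" for m using U_abs_le[OF X] by simp
    have "\<bar>theta_U q n X\<bar> \<le> (\<Sum>j. \<bar>theta_coeff q j * gauss q n j * U (n + 2 * j) X\<bar>)"
      unfolding theta_U_def by (intro summable_rabs summable_theta_U_term[where v = "\<lambda>m. U m X" and c = 1] U assms)
    also have "\<dots> \<le> (\<Sum>j. 1 * K * (real n + 1) * (real (Suc j) * \<bar>q\<bar> ^ j))"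
      by (intro suminf_le K(2)[of "\<lambda>m. U m X"] U summable_theta_U_term[where v = "\<lambda>m. U m X" and c = 1] summable_mult
            summable_Suc_power assms)
    also have "\<dots> = K * (real n + 1) * S"
      unfolding S_def by (subst suminf_mult) (simp_all add: summable_Suc_power[OF assms] del: of_nat_Suc)
    finally show "\<bar>theta_U q n X\<bar> \<le> K * S * (real n + 1)" by (simp add: mult_ac)
  qed (use K S in auto)
qed

text \<open>By X U_(m+1) = U_(m+2) + U_m, the left side is the coefficient of
  \<open>U (Suc (Suc n) + 2 * j) X\<close> in X Theta_(n+1) - Theta_n. The q-Pascal rule merges its
  last two terms, and absorption does the rest.\<close>

lemma theta_U_coeff_recurrence:
  assumes "\<bar>q\<bar> < 1"
  shows "theta_coeff q j * gauss q (Suc n) j + theta_coeff q (Suc j) * gauss q (Suc n) (Suc j)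
    - theta_coeff q (Suc j) * gauss q n (Suc j) = (1 - q ^ Suc (Suc n)) * (theta_coeff q j * gauss q (Suc (Suc n)) j)"
proof -
  have "theta_coeff q j * gauss q (Suc n) j + theta_coeff q (Suc j) * gauss q (Suc n) (Suc j)
    - theta_coeff q (Suc j) * gauss q n (Suc j)
    = theta_coeff q j * gauss q (Suc n) j + theta_coeff q (Suc j) * (q ^ Suc n * gauss q (Suc n) j)"
    using gauss_pascal[OF assms, of n j] by (simp add: algebra_simps)
  also have "\<dots> = theta_coeff q j * ((1 - q ^ Suc (Suc n + j)) * gauss q (Suc n) j)"
    by (simp add: theta_coeff_Suc algebra_simps power_add)
  also have "\<dots> = (1 - q ^ Suc (Suc n)) * (theta_coeff q j * gauss q (Suc (Suc n)) j)"
    unfolding gauss_absorb[OF assms, symmetric] by (simp only: mult_ac)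
  finally show ?thesis .
qed

lemma theta_U_recurrence:
  assumes "\<bar>q\<bar> < 1" "\<bar>X\<bar> \<le> 2"
  shows "(1 - q ^ Suc (Suc n)) * theta_U q (Suc (Suc n)) X = X * theta_U q (Suc n) X - theta_U q n X"
proof -
  define a where "a n j = theta_coeff q j * gauss q n j" for n j
  have s: "(\<lambda>j. a n j * U (n + 2 * j) X) sums theta_U q n X" for n
    unfolding a_def by (rule theta_U_sums[OF assms])
  have a0: "a n 0 = 1" for n using assms by (simp add: a_def)
  have XU: "X * U (Suc m) X = U (Suc (Suc m)) X + U m X" for m by simp
  have "(\<lambda>j. X * (a (Suc n) j * U (Suc n + 2 * j) X)) sums (X * theta_U q (Suc n) X)"
    by (rule sums_mult[OF s])
  then have A: "(\<lambda>j. a (Suc n) j * U (Suc (Suc n) + 2 * j) X + a (Suc n) j * U (n + 2 * j) X)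
      sums (X * theta_U q (Suc n) X)"
    by (simp add: XU mult.left_commute[of X] distrib_left del: U_simps)
  define f where "f j = (a (Suc n) j - a n j) * U (n + 2 * j) X" for j
  define g where "g j = a (Suc n) j * U (Suc (Suc n) + 2 * j) X" for j
  \<comment> \<open>Only \<open>f\<close> is shifted below, so \<open>g\<close> and \<open>f\<close>
    must converge separately.\<close>
  have gs: "summable g"
    using summable_rabs_cancel[OF summable_theta_U_term[where v = "\<lambda>m. U (Suc m) X" and c = 2 and n = "Suc n", OF assms(1)]]
      U_Suc_abs_le[OF assms(2)]
    by (simp only: g_def[abs_def] a_def add_Suc)
  have fg: "(\<lambda>j. g j + f j) sums (X * theta_U q (Suc n) X - theta_U q n X)"
    using sums_diff[OF A s[of n]] by (simp add: f_def g_def algebra_simps)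
  have fs: "summable f"
    using summable_diff[OF sums_summable[OF fg] gs] by simp
  \<comment> \<open>All leading coefficients \<open>a n 0\<close> are 1, hence
    \<open>f 0 = 0\<close> and the shift loses no term.\<close>
  have "(\<lambda>j. f (Suc j)) sums suminf f"
    using summable_sums[OF fs] by (subst sums_Suc_iff) (simp add: f_def a0)
  then have "(\<lambda>j. g j + f (Suc j)) sums (suminf g + suminf f)"
    by (intro sums_add summable_sums gs)
  moreover have "g j + f (Suc j) = (1 - q ^ Suc (Suc n)) * (a (Suc (Suc n)) j * U (Suc (Suc n) + 2 * j) X)" for j
  proof -
    have "g j + f (Suc j) = (a (Suc n) j + a (Suc n) (Suc j) - a n (Suc j)) * U (Suc (Suc n) + 2 * j) X"
      by (simp add: g_def f_def algebra_simps del: U_simps)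
    then show ?thesis
      unfolding a_def theta_U_coeff_recurrence[OF assms(1)] by (simp only: mult_ac)
  qed
  ultimately have "(\<lambda>j. (1 - q ^ Suc (Suc n)) * (a (Suc (Suc n)) j * U (Suc (Suc n) + 2 * j) X)) sums (suminf g + suminf f)"
    by simp
  then have "(1 - q ^ Suc (Suc n)) * theta_U q (Suc (Suc n)) X = suminf g + suminf f"
    using sums_mult[OF s[of "Suc (Suc n)"]] sums_unique2 by blast
  also have "\<dots> = X * theta_U q (Suc n) X - theta_U q n X"
    using fg sums_add[OF summable_sums[OF gs] summable_sums[OF fs]] sums_unique2 by blast
  finally show ?thesis .
qed

text \<open>The start of the recurrence, where Theta_(-1) counts as 0.\<close>

lemma theta_U_recurrence_0:
  assumes "\<bar>q\<bar> < 1" "\<bar>X\<bar> \<le> 2"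
  shows "(1 - q) * theta_U q (Suc 0) X = X * theta_U q 0 X"
proof -
  have s: "(\<lambda>j. theta_coeff q j * gauss q n j * U (n + 2 * j) X) sums theta_U q n X" for n
    by (rule theta_U_sums[OF assms])
  \<comment> \<open>The value 0 at j = 0 stands for U_(-1); there \<open>2 * j - 1\<close> would
    truncate to 0 and give U_0 = 1.\<close>
  define f where "f j = theta_coeff q j * (if j = 0 then 0 else U (2 * j - 1) X)" for j
  define g where "g j = theta_coeff q j * U (Suc (2 * j)) X" for j
  have "summable (\<lambda>j. theta_coeff q j * gauss q 0 j * U (Suc (0 + 2 * j)) X)"
    using U_Suc_abs_le[OF assms(2)]
    by (rule summable_rabs_cancel[OF summable_theta_U_term[OF assms(1), where v = "\<lambda>m. U (Suc m) X" and c = 2]])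
  then have gs: "summable g"
    using assms(1) unfolding g_def by simp
  have "X * (theta_coeff q j * gauss q 0 j * U (0 + 2 * j) X) = g j + f j" for j
    using assms(1) by (cases j) (simp_all add: g_def f_def algebra_simps)
  then have fg: "(\<lambda>j. g j + f j) sums (X * theta_U q 0 X)"
    using sums_mult[OF s[of 0], of X] by simp
  have fs: "summable f"
    using summable_diff[OF sums_summable[OF fg] gs] by simp
  have "(\<lambda>j. f (Suc j)) sums suminf f"
    using summable_sums[OF fs] by (subst sums_Suc_iff) (simp add: f_def)
  then have "(\<lambda>j. g j + f (Suc j)) sums (suminf g + suminf f)"
    by (intro sums_add summable_sums gs)
  moreover have "g j + f (Suc j) = (1 - q) * (theta_coeff q j * gauss q (Suc 0) j * U (Suc 0 + 2 * j) X)" for j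
  proof -
    have "g j + f (Suc j) = theta_coeff q j * (1 - q ^ Suc j) * U (Suc 0 + 2 * j) X"
      by (simp add: g_def f_def theta_coeff_Suc algebra_simps del: U_simps)
    also have "1 - q ^ Suc j = (1 - q) * gauss q (Suc 0) j"
      using gauss_absorb[OF assms(1), of 0 j] assms(1) by simp
    finally show ?thesis by (simp only: mult_ac)
  qed
  ultimately have "(\<lambda>j. (1 - q) * (theta_coeff q j * gauss q (Suc 0) j * U (Suc 0 + 2 * j) X)) sums (suminf g + suminf f)"
    by simp
  then have "(1 - q) * theta_U q (Suc 0) X = suminf g + suminf f"
    using sums_mult[OF s[of "Suc 0"]] sums_unique2 by blast
  also have "\<dots> = X * theta_U q 0 X"
    using fg sums_add[OF summable_sums[OF gs] summable_sums[OF fs]] sums_unique2 by blast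
  finally show ?thesis .
qed

lemma theta_U_eq_herm:
  assumes "\<bar>q\<bar> < 1" "\<bar>X\<bar> \<le> 2"
  shows "q_poch q n * theta_U q n X = herm q n X * theta_U q 0 X"
proof (induction n rule: induct_nat_012)
  case 0
  then show ?case by simp
next
  case 1
  then show ?case using theta_U_recurrence_0[OF assms] by (simp add: q_poch_Suc)
next
  case (ge2 n)
  have "q_poch q (Suc (Suc n)) * theta_U q (Suc (Suc n)) X = q_poch q (Suc n) * (X * theta_U q (Suc n) X - theta_U q n X)"
    unfolding theta_U_recurrence[OF assms, symmetric] by (simp only: q_poch_Suc mult_ac)
  also have "\<dots> = X * (q_poch q (Suc n) * theta_U q (Suc n) X) - (1 - q ^ Suc n) * (q_poch q n * theta_U q n X)"
    by (simp add: q_poch_Suc algebra_simps)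
  also have "\<dots> = herm q (Suc (Suc n)) X * theta_U q 0 X"
    unfolding ge2 by (simp add: algebra_simps)
  finally show ?case .
qed

section \<open>The triple product\<close>

text \<open>Row and column form of \<open>gauss\<close>, extended by 0 so that neighbouring columns
  may lie beyond the end of a row.\<close>

definition gbin :: "real \<Rightarrow> nat \<Rightarrow> nat \<Rightarrow> real" where
  "gbin q n k = (if k \<le> n then gauss q (n - k) k else 0)"

lemma gauss_sym: "gauss q n j = gauss q j n"
  by (simp add: gauss_def add.commute mult.commute)

lemma gbin_pascal1:
  assumes "\<bar>q\<bar> < 1" "k \<le> n"
  shows "gbin q (Suc n) (Suc k) = gbin q n (Suc k) + q ^ (n - k) * gbin q n k"
proof (cases "k = n")
  case True
  then show ?thesis using assms by (simp add: gbin_def)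
next
  case False
  then obtain d where "n = k + Suc d"
    using assms(2) by (metis le_antisym less_iff_Suc_add not_less add_Suc_right)
  then show ?thesis
    using gauss_pascal[OF assms(1), of d k] by (simp add: gbin_def algebra_simps)
qed

lemma gbin_pascal2:
  assumes "\<bar>q\<bar> < 1"
  shows "gbin q (Suc n) (Suc k) = q ^ Suc k * gbin q n (Suc k) + gbin q n k"
proof (cases "k < n")
  case True
  then obtain d where "n = k + Suc d"
    by (metis less_iff_Suc_add add_Suc_right)
  then show ?thesis
    using gauss_pascal[OF assms(1), of k d]
    by (simp add: gbin_def algebra_simps gauss_sym[of q "Suc k"] gauss_sym[of q k])
next
  case False
  then show ?thesis using assms by (auto simp: gbin_def)
qed

text \<open>The central coefficients are indexed by \<open>N + j + 1\<close> rather than by the symmetric \<open>N - j\<close>, so that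
  they vanish for \<open>j > N\<close> without truncated subtraction.\<close>

lemma gbin_two_steps:
  assumes "\<bar>q\<bar> < 1" "j \<le> Suc N"
  shows "gbin q (2 * N + 3) (N + j + 2) = (1 + (q ^ Suc N)\<^sup>2) * gbin q (2 * N + 1) (N + j + 1)
     + q ^ (Suc N - j) * gbin q (2 * N + 1) (N + j) + q ^ (N + j + 2) * gbin q (2 * N + 1) (N + j + 2)"
proof -
  have e: "2 * N + 2 - (N + j + 1) = Suc N - j" using assms by simp
  have "gbin q (2 * N + 3) (N + j + 2) = gbin q (2 * N + 2) (N + j + 2) + q ^ (Suc N - j) * gbin q (2 * N + 2) (N + j + 1)"
    using gbin_pascal1[OF assms(1), of "N + j + 1" "2 * N + 2"] assms(2) unfolding e
    by (simp add: numeral_eq_Suc)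
  also have "gbin q (2 * N + 2) (N + j + 2) = q ^ (N + j + 2) * gbin q (2 * N + 1) (N + j + 2) + gbin q (2 * N + 1) (N + j + 1)"
    using gbin_pascal2[OF assms(1), of "2 * N + 1" "N + j + 1"] by (simp add: numeral_eq_Suc)
  also have "gbin q (2 * N + 2) (N + j + 1) = q ^ (N + j + 1) * gbin q (2 * N + 1) (N + j + 1) + gbin q (2 * N + 1) (N + j)"
    using gbin_pascal2[OF assms(1), of "2 * N + 1" "N + j"] by (simp add: numeral_eq_Suc)
  also have "q ^ (Suc N - j) * (q ^ (N + j + 1) * gbin q (2 * N + 1) (N + j + 1) + gbin q (2 * N + 1) (N + j))
     = (q ^ Suc N)\<^sup>2 * gbin q (2 * N + 1) (N + j + 1) + q ^ (Suc N - j) * gbin q (2 * N + 1) (N + j)"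
  proof -
    have "Suc N - j + (N + j + 1) = Suc N + Suc N" using assms by simp
    then have "q ^ (Suc N - j) * q ^ (N + j + 1) = (q ^ Suc N)\<^sup>2"
      by (metis power_add power2_eq_square)
    then show ?thesis by (simp only: distrib_left mult.assoc[symmetric])
  qed
  finally show ?thesis by (simp add: algebra_simps)
qed

text \<open>In general X^2 U_(2j) = U_(2j+2) + 2 U_(2j) + U_(2j-2). At j = 0 the last term is U_(-2)
  = -1, whence \<open>- s 0\<close>; the term with \<open>s (Suc N)\<close> removes a summand that
  the uniform coefficient introduces at j = N.\<close>

lemma square_times_sum_U_even:
  fixes s :: "nat \<Rightarrow> real"
  shows "X\<^sup>2 * (\<Sum>j\<le>N. s j * U (2 * j) X) =
     (\<Sum>j\<le>N. (2 * s j + s (Suc j)) * U (2 * j) X) + (\<Sum>j\<le>N. s j * U (2 * Suc j) X)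
     - s 0 - s (Suc N) * U (2 * N) X"
proof (induction N)
  case 0
  show ?case by (simp add: algebra_simps power2_eq_square)
next
  case (Suc N)
  have "X\<^sup>2 * U (2 * Suc N) X = U (2 * Suc (Suc N)) X + 2 * U (2 * Suc N) X + U (2 * N) X"
    by (simp add: algebra_simps power2_eq_square)
  then have e: "X\<^sup>2 * (s (Suc N) * U (2 * Suc N) X)
      = s (Suc N) * (U (2 * Suc (Suc N)) X + 2 * U (2 * Suc N) X + U (2 * N) X)"
    by (simp only: mult.left_commute[of "X\<^sup>2"])
  show ?case
    unfolding sum.atMost_Suc distrib_left[of "X\<^sup>2"] Suc e
    by (simp only: algebra_simps)
qed

text \<open>For X = 2 cos u this is (1 - t e^(2iu)) (1 - t e^(-2iu)).\<close>

definition theta_factor :: "real \<Rightarrow> real \<Rightarrow> real" where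
  "theta_factor X t = (1 + t)\<^sup>2 - X\<^sup>2 * t"

text \<open>Multiplied by sin u, with X = 2 cos u, the sum runs over the odd harmonics sin((2j+1)
  u); hence an odd row of binomials, of which only the right half is listed. In the induction the
  factor for Q = q^(N+1) acts through \<open>square_times_sum_U_even\<close>, and the row grows by
  two.\<close>

lemma finite_triple_product:
  assumes "\<bar>q\<bar> < 1"
  shows "(\<Prod>k<N. theta_factor X (q ^ Suc k)) =
    (\<Sum>j\<le>N. theta_coeff q j * gbin q (2 * N + 1) (N + j + 1) * U (2 * j) X)"
proof (induction N)
  case 0
  show ?case using assms by (simp add: gbin_def)
next
  case (Suc N)
  define Q where "Q = q ^ Suc N"
  define s where "s j = theta_coeff q j * gbin q (2 * N + 1) (N + j + 1)" for j
  define s' where "s' j = theta_coeff q j * gbin q (2 * N + 3) (N + j + 2)" for j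
  define f where "f j = ((1 + Q\<^sup>2) * s j - Q * s (Suc j)) * U (2 * j) X" for j
  have s0: "s (Suc N) = 0" "s (Suc (Suc N)) = 0"
    by (simp_all add: s_def gbin_def)
  \<comment> \<open>At j = 0 the column N lies left of the centre. Symmetry of the row folds it
    back, and the resulting \<open>Q * s 0\<close> matches the boundary term of
    \<open>square_times_sum_U_even\<close>.\<close>
  have s'0: "s' 0 = f 0 + Q * s 0"
  proof -
    have "gbin q (2 * N + 1) N = gbin q (2 * N + 1) (N + 1)"
      using gauss_sym[of q N "Suc N"] by (simp add: gbin_def numeral_eq_Suc)
    then show ?thesis
      using gbin_two_steps[OF assms, of 0 N]
      by (simp add: s'_def s_def f_def Q_def theta_coeff_Suc algebra_simps power_add power2_eq_square)
  qed
  have s'S: "s' (Suc j) * U (2 * Suc j) X = f (Suc j) - Q * s j * U (2 * Suc j) X" if "j \<le> N" for j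
  proof -
    have Qe: "q ^ (Suc N - Suc j) * theta_coeff q (Suc j) = - Q * theta_coeff q j"
    proof -
      have "Suc N - Suc j + Suc j = Suc N" using that by simp
      then have "q ^ (Suc N - Suc j) * q ^ Suc j = Q"
        unfolding Q_def by (metis power_add)
      then show ?thesis by (simp only: theta_coeff_Suc) (simp add: algebra_simps)
    qed
    have Qf: "q ^ (N + Suc j + 2) * theta_coeff q (Suc j) = - Q * theta_coeff q (Suc (Suc j))"
      by (simp add: theta_coeff_Suc Q_def power_add algebra_simps power2_eq_square)
    have "s' (Suc j) = (1 + Q\<^sup>2) * s (Suc j) + q ^ (Suc N - Suc j) * theta_coeff q (Suc j) * gbin q (2 * N + 1) (N + Suc j)
        + q ^ (N + Suc j + 2) * theta_coeff q (Suc j) * gbin q (2 * N + 1) (N + Suc j + 2)"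
      unfolding s'_def s_def using that
      by (subst gbin_two_steps[OF assms]) (simp_all only: Suc_le_mono Q_def[symmetric] distrib_left mult_ac)
    also have "\<dots> = (1 + Q\<^sup>2) * s (Suc j) - Q * s j - Q * s (Suc (Suc j))"
      unfolding Qe Qf by (simp add: s_def)
    finally have "s' (Suc j) = (1 + Q\<^sup>2) * s (Suc j) - Q * s j - Q * s (Suc (Suc j))" .
    then show ?thesis unfolding f_def by algebra
  qed
  have "(\<Prod>k<Suc N. theta_factor X (q ^ Suc k)) = theta_factor X Q * (\<Sum>j\<le>N. s j * U (2 * j) X)"
    using Suc by (simp add: Q_def s_def)
  also have "\<dots> = (1 + Q)\<^sup>2 * (\<Sum>j\<le>N. s j * U (2 * j) X) - Q * (X\<^sup>2 * (\<Sum>j\<le>N. s j * U (2 * j) X))"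
    by (simp add: theta_factor_def algebra_simps)
  also have "\<dots> = (\<Sum>j\<le>N. f j) - Q * (\<Sum>j\<le>N. s j * U (2 * Suc j) X) + Q * s 0"
    unfolding square_times_sum_U_even s0 f_def
    by (simp add: sum_distrib_left sum.distrib sum_subtractf algebra_simps power2_eq_square del: U_simps mult_Suc_right)
  also have "(\<Sum>j\<le>N. f j) = (\<Sum>j\<le>Suc N. f j)"
    by (simp add: f_def s0)
  also have "\<dots> = f 0 + (\<Sum>j\<le>N. f (Suc j))"
    by (rule sum.atMost_Suc_shift)
  also have "f 0 + (\<Sum>j\<le>N. f (Suc j)) - Q * (\<Sum>j\<le>N. s j * U (2 * Suc j) X) + Q * s 0
     = s' 0 + (\<Sum>j\<le>N. f (Suc j) - Q * s j * U (2 * Suc j) X)"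
    by (simp add: s'0 sum_subtractf sum_distrib_left mult.assoc)
  also have "\<dots> = s' 0 * U (2 * 0) X + (\<Sum>j\<le>N. s' (Suc j) * U (2 * Suc j) X)"
    using s'S by simp
  also have "\<dots> = (\<Sum>j\<le>Suc N. s' j * U (2 * j) X)"
    by (rule sum.atMost_Suc_shift[symmetric])
  finally show ?case
    by (simp only: s'_def) (simp add: numeral_eq_Suc)
qed

text \<open>The central binomials tend to 1 / (q)_inf for fixed j, and their uniform bound allows
  the limit to be taken termwise (Tannery).\<close>

lemma tendsto_theta_product:
  assumes "\<bar>q\<bar> < 1" "\<bar>X\<bar> \<le> 2"
  shows "(\<lambda>N. \<Prod>k<N. theta_factor X (q ^ Suc k)) \<longlonglongrightarrow> theta_U q 0 X / q_poch_inf q q"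
proof -
  define Q where "Q = q_poch_inf q q"
  have Q: "Q \<noteq> 0" "q_poch q \<longlonglongrightarrow> Q"
    using q_poch_inf_nonzero[OF assms(1)] q_poch_LIMSEQ[OF assms(1)] by (simp_all add: Q_def)
  obtain K where K: "K > 0" "\<And>n j. \<bar>gauss q n j\<bar> \<le> K"
    using gauss_bounded[OF assms(1)] by metis
  define a where "a j N = theta_coeff q j * gbin q (2 * N + 1) (N + j + 1) * U (2 * j) X" for j N
  have lim: "(\<lambda>N. a j N) \<longlonglongrightarrow> theta_coeff q j * inverse Q * U (2 * j) X" for j
    unfolding a_def
  proof (intro tendsto_mult tendsto_const)
    \<comment> \<open>With N + j in place of N the column never exceeds the row;
      \<open>LIMSEQ_offset\<close> undoes the shift.\<close>
    have l: "(\<lambda>N. q_poch q (2 * (N + j) + 1) / (q_poch q N * q_poch q (N + 2 * j + 1))) \<longlonglongrightarrow> Q / (Q * Q)"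
      by (intro tendsto_divide tendsto_mult Q filterlim_compose[OF Q(2)]) (use Q in \<open>auto intro!: filterlim_subseq simp: strict_mono_def\<close>)
    have "(\<lambda>N. gbin q (2 * (N + j) + 1) (N + j + j + 1)) \<longlonglongrightarrow> inverse Q"
    proof -
      have "gbin q (2 * (N + j) + 1) (N + j + j + 1) = q_poch q (2 * (N + j) + 1) / (q_poch q N * q_poch q (N + 2 * j + 1))" for N
        by (simp add: gbin_def gauss_def mult_2 add_ac)
      moreover have "Q / (Q * Q) = inverse Q" using Q(1) by (simp add: field_simps)
      ultimately show ?thesis using l by simp
    qed
    then show "(\<lambda>N. gbin q (2 * N + 1) (N + j + 1)) \<longlonglongrightarrow> inverse Q"
      by (rule LIMSEQ_offset)
  qed
  have bound: "norm (a j N) \<le> 2 * K * (real (Suc j) * \<bar>q\<bar> ^ j)" for j N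
  proof -
    have "\<bar>gbin q (2 * N + 1) (N + j + 1)\<bar> \<le> K" using K by (auto simp: gbin_def less_imp_le)
    moreover have "\<bar>U (2 * j) X\<bar> \<le> 2 * real (Suc j)"
      using U_abs_le[OF assms(2), of "2 * j"] by simp
    ultimately have "\<bar>theta_coeff q j\<bar> * \<bar>gbin q (2 * N + 1) (N + j + 1)\<bar> * \<bar>U (2 * j) X\<bar>
       \<le> \<bar>q\<bar> ^ j * K * (2 * real (Suc j))"
      using K by (intro mult_mono theta_coeff_abs_le assms) auto
    then show ?thesis by (simp add: a_def abs_mult mult_ac del: of_nat_Suc)
  qed
  have "(\<lambda>N. \<Sum>j. a j N) \<longlonglongrightarrow> (\<Sum>j. theta_coeff q j * inverse Q * U (2 * j) X)"
    by (rule conjunct2[OF conjunct2[OF tannerys_theorem[OF lim,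
          where M = "\<lambda>j. 2 * K * (real (Suc j) * \<bar>q\<bar> ^ j)"]]])
       (use bound in \<open>auto intro!: summable_mult summable_Suc_power assms always_eventually simp del: of_nat_Suc\<close>)
  moreover have "(\<Sum>j. a j N) = (\<Prod>k<N. theta_factor X (q ^ Suc k))" for N
    unfolding finite_triple_product[OF assms(1)] a_def
    by (intro suminf_finite) (auto simp: gbin_def)
  moreover have "(\<Sum>j. theta_coeff q j * inverse Q * U (2 * j) X) = theta_U q 0 X / Q"
    using sums_divide[OF theta_U_sums[OF assms, of 0], of Q] assms(1)
    by (simp add: sums_iff field_simps)
  ultimately show ?thesis by (simp add: Q_def)
qed

section \<open>Nonvanishing of the theta product and growth of the q-Hermite polynomials\<close>

lemma theta_factor_pos:
  assumes "\<bar>X\<bar> \<le> 2" "\<bar>t\<bar> < 1"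
  shows "theta_factor X t > 0"
proof (cases "t \<ge> 0")
  case True
  have "X\<^sup>2 \<le> 4" using assms(1) abs_le_square_iff[of X 2] by simp
  then have "X\<^sup>2 * t \<le> 4 * t" using True by (rule mult_right_mono)
  moreover have "(1 - t)\<^sup>2 > 0" using assms by simp
  ultimately show ?thesis
    by (simp add: theta_factor_def power2_eq_square algebra_simps)
next
  case False
  then have "X\<^sup>2 * t \<le> 0" by (simp add: mult_nonneg_nonpos)
  moreover have "(1 + t)\<^sup>2 > 0" using assms by (auto simp: abs_if split: if_splits)
  ultimately show ?thesis unfolding theta_factor_def by linarith
qed

lemma convergent_prod_theta_factor:
  assumes "\<bar>q\<bar> < 1"
  shows "convergent_prod (\<lambda>k. theta_factor X (q ^ k))"
proof (rule convergent_prod_geometric[OF assms, of _ "1 + \<bar>2 - X\<^sup>2\<bar>"])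
  fix k
  have le: "\<bar>q ^ k\<bar> \<le> 1"
    using assms by (simp add: power_abs power_le_one)
  have "\<bar>theta_factor X (q ^ k) - 1\<bar> = \<bar>(2 - X\<^sup>2) + q ^ k\<bar> * \<bar>q ^ k\<bar>"
    by (simp add: theta_factor_def abs_mult[symmetric] power2_eq_square algebra_simps)
  also have "\<dots> \<le> (1 + \<bar>2 - X\<^sup>2\<bar>) * \<bar>q ^ k\<bar>"
    using le by (intro mult_right_mono) auto
  finally show "\<bar>theta_factor X (q ^ k) - 1\<bar> \<le> (1 + \<bar>2 - X\<^sup>2\<bar>) * \<bar>q\<bar> ^ k"
    by (simp add: power_abs)
qed

text \<open>Without k = 0 all arguments of \<open>theta_factor\<close> have modulus below 1, where
  it is positive even for X = 2 or X = -2.\<close>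

lemma theta_U_0_eq:
  assumes "\<bar>q\<bar> < 1" "\<bar>X\<bar> \<le> 2"
  shows "theta_U q 0 X = q_poch_inf q q * (\<Prod>k. theta_factor X (q ^ Suc k))" and "theta_U q 0 X \<noteq> 0"
proof -
  have cp: "convergent_prod (\<lambda>k. theta_factor X (q ^ Suc k))"
    using convergent_prod_theta_factor[OF assms(1), of X]
    by (subst convergent_prod_Suc_iff)
  have "(\<Prod>k. theta_factor X (q ^ Suc k)) = theta_U q 0 X / q_poch_inf q q"
    using LIMSEQ_unique[OF prod_lessThan_LIMSEQ[OF cp] tendsto_theta_product[OF assms]] .
  then show eq: "theta_U q 0 X = q_poch_inf q q * (\<Prod>k. theta_factor X (q ^ Suc k))"
    using q_poch_inf_nonzero[OF assms(1)] by simp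
  have "theta_factor X (q ^ Suc k) \<noteq> 0" for k
    using theta_factor_pos[OF assms(2) abs_power_Suc_less_one[OF assms(1)], of k] by linarith
  then have "(\<Prod>k. theta_factor X (q ^ Suc k)) \<noteq> 0"
    by (intro prodinf_nonzero cp)
  then show "theta_U q 0 X \<noteq> 0"
    using q_poch_inf_nonzero[OF assms(1)] by (simp add: eq)
qed

text \<open>Division of \<open>theta_U_eq_herm\<close> by Theta_0 transfers the linear growth of
  Theta_n to h_n; the constant depends on X.\<close>

lemma herm_abs_le:
  assumes "\<bar>q\<bar> < 1" "\<bar>X\<bar> \<le> 2"
  obtains K where "K > 0" "\<And>n. \<bar>herm q n X\<bar> \<le> K * (real n + 1)"
proof -
  obtain K where K: "K > 0" "\<And>n X. \<bar>X\<bar> \<le> 2 \<Longrightarrow> \<bar>theta_U q n X\<bar> \<le> K * (real n + 1)"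
    using theta_U_abs_le[OF assms(1)] by metis
  obtain L where L: "L > 0" "\<And>n. q_poch q n \<le> L"
    using q_poch_bounded[OF assms(1)] by metis
  note T0 = theta_U_0_eq(2)[OF assms]
  show ?thesis
  proof (rule that[of "L * K / \<bar>theta_U q 0 X\<bar>"])
    fix n
    have "\<bar>herm q n X\<bar> * \<bar>theta_U q 0 X\<bar> = q_poch q n * \<bar>theta_U q n X\<bar>"
      using theta_U_eq_herm[OF assms, of n] q_poch_pos[OF assms(1), of n] by (metis abs_mult abs_of_pos)
    also have "\<dots> \<le> L * (K * (real n + 1))"
      using K L assms q_poch_pos[OF assms(1), of n] by (intro mult_mono) auto
    finally show "\<bar>herm q n X\<bar> \<le> L * K / \<bar>theta_U q 0 X\<bar> * (real n + 1)"
      using T0 by (simp add: field_simps)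
  qed (use K L T0 in auto)
qed

lemma summable_Suc_square_power:
  fixes r :: real
  assumes "\<bar>r\<bar> < 1"
  shows "summable (\<lambda>n. (real n + 1)\<^sup>2 * \<bar>r\<bar> ^ n)"
proof -
  \<comment> \<open>The term is the square of (n+1) s^n, and a nonnegative summable sequence is
    bounded, so its square is summable.\<close>
  define s where "s = sqrt \<bar>r\<bar>"
  have s: "\<bar>s\<bar> < 1" "s \<ge> 0" "s\<^sup>2 = \<bar>r\<bar>" using assms by (simp_all add: s_def)
  define f where "f n = (real n + 1) * s ^ n" for n
  have sf: "summable f"
    using summable_Suc_power[OF s(1)] s(2) by (simp add: f_def[abs_def] add.commute)
  have f0: "f n \<ge> 0" for n using s by (simp add: f_def)
  obtain K where K: "\<And>n. norm (f n) \<le> K"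
    using summable_imp_Bseq[OF sf] by (auto simp: Bseq_def)
  have "summable (\<lambda>n. f n * f n)"
  proof (rule summable_comparison_test[OF _ summable_mult[OF sf, of K]])
    show "\<exists>N. \<forall>n\<ge>N. norm (f n * f n) \<le> K * f n"
      using K f0 by (auto simp: abs_mult intro!: mult_right_mono)
  qed
  moreover have "f n * f n = (real n + 1)\<^sup>2 * \<bar>r\<bar> ^ n" for n
    unfolding f_def s(3)[symmetric] by (simp add: power2_eq_square power_mult_distrib mult_ac)
  ultimately show ?thesis by simp
qed

section \<open>The Poisson-Mehler kernel\<close>

text \<open>For X = 2 cos s and Y = 2 cos t this is the product of 1 - r e^(i(+-s+-t)) over the four
  choices of signs. At r = rho q^k it is the k-th denominator of \<open>f_CN\<close>, at r = rho the
  W of \<open>f_K\<close>.\<close>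

definition mehler_denom :: "real \<Rightarrow> real \<Rightarrow> real \<Rightarrow> real" where
  "mehler_denom X Y r = (1 - r\<^sup>2)\<^sup>2 - r * (1 + r\<^sup>2) * X * Y + r\<^sup>2 * (X\<^sup>2 + Y\<^sup>2)"

lemma mehler_denom_pos:
  assumes "\<bar>X\<bar> \<le> 2" "\<bar>Y\<bar> \<le> 2" "\<bar>r\<bar> < 1"
  shows "mehler_denom X Y r > 0"
proof -
  define s t where "s = arccos (X / 2)" and "t = arccos (Y / 2)"
  have X: "X = 2 * cos s" and Y: "Y = 2 * cos t"
    using assms by (simp_all add: s_def t_def)
  have sq: "(sin s)\<^sup>2 = 1 - (cos s)\<^sup>2" "(sin t)\<^sup>2 = 1 - (cos t)\<^sup>2"
    by (simp_all add: sin_squared_eq)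
  have "mehler_denom X Y r = (1 + r\<^sup>2 - 2 * r * cos s * cos t)\<^sup>2 - 4 * r\<^sup>2 * ((1 - (cos s)\<^sup>2) * (1 - (cos t)\<^sup>2))"
    unfolding mehler_denom_def X Y by algebra
  also have "\<dots> = (1 + r\<^sup>2 - 2 * r * cos (s - t)) * (1 + r\<^sup>2 - 2 * r * cos (s + t))"
    unfolding sq[symmetric] cos_add cos_diff by algebra
  finally have mehler_denom: "mehler_denom X Y r = (1 + r\<^sup>2 - 2 * r * cos (s - t)) * (1 + r\<^sup>2 - 2 * r * cos (s + t))" .
  have "1 + r\<^sup>2 - 2 * r * cos u > 0" for u
  proof -
    have "\<bar>r * cos u\<bar> \<le> \<bar>r\<bar> * 1"
      unfolding abs_mult by (intro mult_left_mono) auto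
    then have "r * cos u \<le> \<bar>r\<bar>" by linarith
    moreover have "(1 - \<bar>r\<bar>)\<^sup>2 > 0" using assms by simp
    ultimately show ?thesis by (simp add: power2_eq_square algebra_simps)
  qed
  then show ?thesis unfolding mehler_denom by simp
qed

lemma convergent_prod_mehler_denom:
  assumes "\<bar>q\<bar> < 1" "\<bar>\<rho>\<bar> \<le> 1"
  shows "convergent_prod (\<lambda>k. mehler_denom X Y (\<rho> * q ^ k))"
proof (rule convergent_prod_geometric[OF assms(1)])
  fix k
  define r where "r = \<rho> * q ^ k"
  have rq: "\<bar>r\<bar> \<le> \<bar>q\<bar> ^ k"
    using assms(2) by (simp add: r_def abs_mult power_abs mult_left_le_one_le)
  also have "\<dots> \<le> 1" using assms by (simp add: power_le_one)
  finally have r: "\<bar>r\<bar> \<le> 1" .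
  have p: "\<bar>c * r ^ n\<bar> \<le> \<bar>c\<bar>" for c n
    using r by (simp add: abs_mult power_abs mult_left_le power_le_one)
  \<comment> \<open>\<open>mehler_denom X Y r - 1\<close> is divisible by r; the cubic quotient is
    bounded coefficientwise because |r| <= 1.\<close>
  have "\<bar>mehler_denom X Y r - 1\<bar> = \<bar>r\<bar> * \<bar>- (X * Y) * r ^ 0 + (X\<^sup>2 + Y\<^sup>2 - 2) * r ^ 1 + - (X * Y) * r ^ 2 + 1 * r ^ 3\<bar>"
    unfolding abs_mult[symmetric] mehler_denom_def by (rule arg_cong[of _ _ abs]) algebra
  also have "\<dots> \<le> \<bar>r\<bar> * (\<bar>- (X * Y)\<bar> + \<bar>X\<^sup>2 + Y\<^sup>2 - 2\<bar> + \<bar>- (X * Y)\<bar> + \<bar>1\<bar>)"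
    by (intro mult_left_mono order_trans[OF abs_triangle_ineq] add_mono p) auto
  also have "\<dots> \<le> \<bar>q\<bar> ^ k * (\<bar>- (X * Y)\<bar> + \<bar>X\<^sup>2 + Y\<^sup>2 - 2\<bar> + \<bar>- (X * Y)\<bar> + \<bar>1\<bar>)"
    by (intro mult_right_mono rq) auto
  finally show "\<bar>mehler_denom X Y (\<rho> * q ^ k) - 1\<bar> \<le> (\<bar>- (X * Y)\<bar> + \<bar>X\<^sup>2 + Y\<^sup>2 - 2\<bar> + \<bar>- (X * Y)\<bar> + \<bar>1\<bar>) * \<bar>q\<bar> ^ k"
    by (simp only: r_def mult.commute)
qed

definition mehler_coeff :: "real \<Rightarrow> real \<Rightarrow> real \<Rightarrow> nat \<Rightarrow> real" where
  "mehler_coeff q X Y n = herm q n X * herm q n Y / q_poch q n"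

text \<open>The coefficient of r^(n+4) in \<open>mehler_functional_equation\<close>. Products of
  solutions of two second order recurrences obey one of order four, hence five terms.\<close>

lemma mehler_coeff_recurrence:
  assumes "\<bar>q\<bar> < 1"
  shows "(1 - q ^ (n + 4)) * mehler_coeff q X Y (n + 4) - X * Y * mehler_coeff q X Y (n + 3)
     + (X\<^sup>2 + Y\<^sup>2 - 2 + (1 + q) * q ^ (n + 2)) * mehler_coeff q X Y (n + 2)
     - X * Y * mehler_coeff q X Y (n + 1) + (1 - q ^ (n + 1)) * mehler_coeff q X Y n = 0"
proof -
  define p e1 e2 e3 e4 where "p = q_poch q n" and "e1 = 1 - q ^ (n + 1)" and "e2 = 1 - q ^ (n + 2)"
    and "e3 = 1 - q ^ (n + 3)" and "e4 = 1 - q ^ (n + 4)"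
  note es = p_def e1_def e2_def e3_def e4_def
  have nz: "p \<noteq> 0" "e1 \<noteq> 0" "e2 \<noteq> 0" "e3 \<noteq> 0" "e4 \<noteq> 0"
    using q_poch_pos[OF assms, of n] one_minus_power_pos[OF assms, of n] one_minus_power_pos[OF assms, of "n + 1"]
      one_minus_power_pos[OF assms, of "n + 2"] one_minus_power_pos[OF assms, of "n + 3"]
    by (auto simp: es numeral_eq_Suc)
  define a0 a1 a2 a3 a4 where "a0 = herm q n X" and "a1 = herm q (n + 1) X" and "a2 = herm q (n + 2) X"
    and "a3 = herm q (n + 3) X" and "a4 = herm q (n + 4) X"
  define b0 b1 b2 b3 b4 where "b0 = herm q n Y" and "b1 = herm q (n + 1) Y" and "b2 = herm q (n + 2) Y"
    and "b3 = herm q (n + 3) Y" and "b4 = herm q (n + 4) Y"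
  note as = a0_def a1_def a2_def a3_def a4_def and bs = b0_def b1_def b2_def b3_def b4_def
  have A: "a2 = X * a1 - e1 * a0" "a3 = X * a2 - e2 * a1" "a4 = X * a3 - e3 * a2"
   and B: "b2 = Y * b1 - e1 * b0" "b3 = Y * b2 - e2 * b1" "b4 = Y * b3 - e3 * b2"
    by (simp_all add: as bs es numeral_eq_Suc)
  have m: "mehler_coeff q X Y (n + 4) = a4 * b4 / (p * e1 * e2 * e3 * e4)"
     "mehler_coeff q X Y (n + 3) = a3 * b3 / (p * e1 * e2 * e3)"
     "mehler_coeff q X Y (n + 2) = a2 * b2 / (p * e1 * e2)"
     "mehler_coeff q X Y (n + 1) = a1 * b1 / (p * e1)"
     "mehler_coeff q X Y n = a0 * b0 / p"
    by (simp_all add: mehler_coeff_def as bs es q_poch_Suc numeral_eq_Suc)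
  have c: "X\<^sup>2 + Y\<^sup>2 - 2 + (1 + q) * q ^ (n + 2) = X\<^sup>2 + Y\<^sup>2 - e2 - e3"
    by (simp add: es numeral_eq_Suc algebra_simps)
  \<comment> \<open>After elimination only a0, a1, b0, b1 are left, and the identity is polynomial
    with e1, e2, e3 as independent variables.\<close>
  have key: "a4 * b4 - X * Y * (a3 * b3) + (X\<^sup>2 + Y\<^sup>2 - e2 - e3) * e3 * (a2 * b2)
     - X * Y * e2 * e3 * (a1 * b1) + e1 * e1 * e2 * e3 * (a0 * b0) = 0"
    unfolding A(3) B(3) A(2) B(2) A(1) B(1) by algebra
  have "e4 * (a4 * b4 / (p * e1 * e2 * e3 * e4)) - X * Y * (a3 * b3 / (p * e1 * e2 * e3))
     + (X\<^sup>2 + Y\<^sup>2 - e2 - e3) * (a2 * b2 / (p * e1 * e2)) - X * Y * (a1 * b1 / (p * e1)) + e1 * (a0 * b0 / p)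
     = (a4 * b4 - X * Y * (a3 * b3) + (X\<^sup>2 + Y\<^sup>2 - e2 - e3) * e3 * (a2 * b2)
     - X * Y * e2 * e3 * (a1 * b1) + e1 * e1 * e2 * e3 * (a0 * b0)) / (p * e1 * e2 * e3)"
    using nz by (simp add: add_divide_distrib diff_divide_distrib)
  then show ?thesis
    unfolding m c using key by (simp add: es)
qed

text \<open>The coefficients of r^0 to r^3 in the functional equation, for which the five-term
  recurrence would reach negative indices.\<close>

lemma mehler_coeff_small:
  assumes "\<bar>q\<bar> < 1"
  shows "mehler_coeff q X Y 0 = 1"
    and "(1 - q) * mehler_coeff q X Y 1 = X * Y"
    and "(1 - q\<^sup>2) * mehler_coeff q X Y 2 = X * Y * mehler_coeff q X Y 1 - (X\<^sup>2 + Y\<^sup>2 - 1 + q)"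
    and "(1 - q ^ 3) * mehler_coeff q X Y 3 = X * Y * mehler_coeff q X Y 2
          - (X\<^sup>2 + Y\<^sup>2 - 2 + (1 + q) * q) * mehler_coeff q X Y 1 + X * Y"
proof -
  define e1 e2 e3 where "e1 = 1 - q" and "e2 = 1 - q ^ 2" and "e3 = 1 - q ^ 3"
  have nz: "e1 \<noteq> 0" "e2 \<noteq> 0" "e3 \<noteq> 0"
    using one_minus_power_pos[OF assms, of 0] one_minus_power_pos[OF assms, of 1]
      one_minus_power_pos[OF assms, of 2] by (auto simp: e1_def e2_def e3_def numeral_eq_Suc)
  have m: "mehler_coeff q X Y 1 = X * Y / e1"
    "mehler_coeff q X Y 2 = (X * X - e1) * (Y * Y - e1) / (e1 * e2)"
    "mehler_coeff q X Y 3 = (X * (X * X - e1) - e2 * X) * (Y * (Y * Y - e1) - e2 * Y) / (e1 * e2 * e3)"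
    by (simp_all add: mehler_coeff_def e1_def e2_def e3_def q_poch_Suc numeral_eq_Suc)
  show "mehler_coeff q X Y 0 = 1" by (simp add: mehler_coeff_def)
  show "(1 - q) * mehler_coeff q X Y 1 = X * Y"
    using nz unfolding m by (simp add: e1_def)
  have "X * Y * (X * Y / e1) - (X\<^sup>2 + Y\<^sup>2 - e1) = (X * X - e1) * (Y * Y - e1) / e1"
    using nz by (simp add: field_simps power2_eq_square)
  then show "(1 - q\<^sup>2) * mehler_coeff q X Y 2 = X * Y * mehler_coeff q X Y 1 - (X\<^sup>2 + Y\<^sup>2 - 1 + q)"
    using nz unfolding m by (simp add: e1_def e2_def)
  have q: "X\<^sup>2 + Y\<^sup>2 - 2 + (1 + q) * q = X\<^sup>2 + Y\<^sup>2 - e1 - e2"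
    by (simp add: e1_def e2_def algebra_simps power2_eq_square)
  have "X * Y * ((X * X - e1) * (Y * Y - e1) / (e1 * e2)) - (X\<^sup>2 + Y\<^sup>2 - e1 - e2) * (X * Y / e1) + X * Y
    = (X * Y * ((X * X - e1) * (Y * Y - e1)) - (X\<^sup>2 + Y\<^sup>2 - e1 - e2) * e2 * (X * Y) + e1 * e2 * (X * Y)) / (e1 * e2)"
    using nz by (simp add: add_divide_distrib diff_divide_distrib)
  also have "\<dots> = (X * (X * X - e1) - e2 * X) * (Y * (Y * Y - e1) - e2 * Y) / (e1 * e2)"
    by (rule arg_cong[of _ _ "\<lambda>z. z / (e1 * e2)"]) algebra
  finally show "(1 - q ^ 3) * mehler_coeff q X Y 3 = X * Y * mehler_coeff q X Y 2
          - (X\<^sup>2 + Y\<^sup>2 - 2 + (1 + q) * q) * mehler_coeff q X Y 1 + X * Y"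
    unfolding q m using nz(3) by (simp add: e3_def)
qed

lemma summable_mehler:
  assumes "\<bar>q\<bar> < 1" "\<bar>X\<bar> \<le> 2" "\<bar>Y\<bar> \<le> 2" "\<bar>r\<bar> < 1"
  shows "summable (\<lambda>n. mehler_coeff q X Y n * r ^ n)"
proof -
  obtain K where K: "K > 0" "\<And>n. \<bar>herm q n X\<bar> \<le> K * (real n + 1)"
    using herm_abs_le[OF assms(1,2)] by metis
  obtain L where L: "L > 0" "\<And>n. \<bar>herm q n Y\<bar> \<le> L * (real n + 1)"
    using herm_abs_le[OF assms(1,3)] by metis
  obtain M where M: "M > 0" "\<And>n. inverse (q_poch q n) \<le> M"
    using q_poch_bounded[OF assms(1)] by metis
  show ?thesis
  proof (rule summable_comparison_test[OF _ summable_mult[OF summable_Suc_square_power[OF assms(4)], of "K * L * M"]],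
      intro exI allI impI)
    fix n
    have "\<bar>herm q n X\<bar> * \<bar>herm q n Y\<bar> * inverse (q_poch q n) * \<bar>r\<bar> ^ n
        \<le> K * (real n + 1) * (L * (real n + 1)) * M * \<bar>r\<bar> ^ n"
      using K L M q_poch_pos[OF assms(1), of n] by (intro mult_mono) auto
    then show "norm (mehler_coeff q X Y n * r ^ n) \<le> K * L * M * ((real n + 1)\<^sup>2 * \<bar>r\<bar> ^ n)"
      using q_poch_pos[OF assms(1), of n]
      by (simp add: mehler_coeff_def abs_mult power_abs divide_inverse power2_eq_square mult_ac)
  qed
qed

definition mehler :: "real \<Rightarrow> real \<Rightarrow> real \<Rightarrow> real \<Rightarrow> real" where
  "mehler q X Y r = (\<Sum>n. mehler_coeff q X Y n * r ^ n)"

lemma mehler_functional_equation: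
  assumes "\<bar>q\<bar> < 1" "\<bar>X\<bar> \<le> 2" "\<bar>Y\<bar> \<le> 2" "\<bar>r\<bar> < 1"
  shows "mehler_denom X Y r * mehler q X Y r = (1 - r\<^sup>2) * (1 - q * r\<^sup>2) * mehler q X Y (r * q)"
proof -
  define m where "m = mehler_coeff q X Y"
  define G H where "G = mehler q X Y r" and "H = mehler q X Y (r * q)"
  have rq: "\<bar>r * q\<bar> < 1"
    using assms by (metis abs_mult abs_ge_zero mult_strict_mono' mult_1)
  have G: "(\<lambda>n. m n * r ^ n) sums G" and H: "(\<lambda>n. m n * (r * q) ^ n) sums H"
    using summable_mehler[OF assms] summable_mehler[OF assms(1-3) rq]
    by (auto simp: G_def H_def m_def mehler_def summable_sums)
  \<comment> \<open>Each power series is cut so that every summand carries r^(n+4); the initial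
    segments removed are accounted for by \<open>small\<close>.\<close>
  have s: "(\<lambda>n. m (n + 4) * r ^ (n + 4) - m (n + 4) * (r * q) ^ (n + 4)
      - X * Y * r * (m (n + 3) * r ^ (n + 3))
      + (X\<^sup>2 + Y\<^sup>2 - 2) * r\<^sup>2 * (m (n + 2) * r ^ (n + 2)) + (1 + q) * r\<^sup>2 * (m (n + 2) * (r * q) ^ (n + 2))
      - X * Y * r ^ 3 * (m (n + 1) * r ^ (n + 1)) + r ^ 4 * (m n * r ^ n) - q * r ^ 4 * (m n * (r * q) ^ n)) sums
     ((G - (\<Sum>n<4. m n * r ^ n)) - (H - (\<Sum>n<4. m n * (r * q) ^ n))
      - X * Y * r * (G - (\<Sum>n<3. m n * r ^ n))
      + (X\<^sup>2 + Y\<^sup>2 - 2) * r\<^sup>2 * (G - (\<Sum>n<2. m n * r ^ n)) + (1 + q) * r\<^sup>2 * (H - (\<Sum>n<2. m n * (r * q) ^ n))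
      - X * Y * r ^ 3 * (G - (\<Sum>n<1. m n * r ^ n)) + r ^ 4 * G - q * r ^ 4 * H)"
    (is "?A sums ?R")
    by (intro sums_add sums_diff sums_mult sums_split_initial_segment G H)
  have A0: "?A = (\<lambda>n. 0)"
  proof
    fix n
    have "?A n = r ^ (n + 4) * ((1 - q ^ (n + 4)) * m (n + 4) - X * Y * m (n + 3)
     + (X\<^sup>2 + Y\<^sup>2 - 2 + (1 + q) * q ^ (n + 2)) * m (n + 2) - X * Y * m (n + 1) + (1 - q ^ (n + 1)) * m n)"
      by (simp add: power_add numeral_eq_Suc algebra_simps)
    then show "?A n = 0"
      unfolding m_def mehler_coeff_recurrence[OF assms(1)] by simp
  qed
  have z: "?R = 0"
    using s unfolding A0 by (rule sums_unique2[OF _ sums_zero])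
  have sums: "(\<Sum>n<4. f n) = f 0 + f 1 + f 2 + f 3" "(\<Sum>n<3. f n) = f 0 + f 1 + f 2"
     "(\<Sum>n<2. f n) = f 0 + f 1" "(\<Sum>n<1. f n) = f 0" for f :: "nat \<Rightarrow> real"
    by (simp_all add: numeral_eq_Suc)
  note small = mehler_coeff_small[OF assms(1), of X Y, folded m_def]
  show ?thesis
    using z small unfolding sums mehler_denom_def G_def[symmetric] H_def[symmetric]
    unfolding power_0 power_one_right mult_1_right by algebra
qed

text \<open>The functional equation at r = rho q^k contributes 1 - rho^2 q^(2k) and 1 - rho^2
  q^(2k+1). So N steps yield the first 2N factors of (rho^2)_inf, while the remaining kernel tends
  to its value 1 at r = 0.\<close>

lemma mehler_formula:
  assumes "\<bar>q\<bar> < 1" "\<bar>X\<bar> \<le> 2" "\<bar>Y\<bar> \<le> 2" "\<bar>\<rho>\<bar> < 1"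
  shows "mehler q X Y \<rho> * (\<Prod>k. mehler_denom X Y (\<rho> * q ^ k)) = q_poch_inf (\<rho>\<^sup>2) q"
proof -
  have small: "\<bar>\<rho> * q ^ k\<bar> < 1" for k
  proof -
    have "\<bar>\<rho> * q ^ k\<bar> \<le> \<bar>\<rho>\<bar>"
      using assms(1) by (simp add: abs_mult power_abs mult_left_le power_le_one)
    with assms(4) show ?thesis by simp
  qed
  have iter: "mehler q X Y \<rho> * (\<Prod>k<N. mehler_denom X Y (\<rho> * q ^ k))
      = (\<Prod>k<2 * N. 1 - \<rho>\<^sup>2 * q ^ k) * mehler q X Y (\<rho> * q ^ N)" for N
  proof (induction N)
    case (Suc N)
    have "mehler q X Y \<rho> * (\<Prod>k<Suc N. mehler_denom X Y (\<rho> * q ^ k))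
       = (\<Prod>k<2 * N. 1 - \<rho>\<^sup>2 * q ^ k) * (mehler_denom X Y (\<rho> * q ^ N) * mehler q X Y (\<rho> * q ^ N))"
      using Suc by (simp add: mult_ac)
    also have "mehler_denom X Y (\<rho> * q ^ N) * mehler q X Y (\<rho> * q ^ N)
       = (1 - (\<rho> * q ^ N)\<^sup>2) * (1 - q * (\<rho> * q ^ N)\<^sup>2) * mehler q X Y (\<rho> * q ^ N * q)"
      by (rule mehler_functional_equation[OF assms(1-3) small])
    finally show ?case
      by (simp add: power_mult_distrib power_mult[symmetric] mult_ac)
  qed simp
  have cont: "isCont (mehler q X Y) 0"
    unfolding mehler_def
    \<comment> \<open>1/2 is merely a nonzero point inside the disc of convergence.\<close>
    by (rule isCont_powser[where K = "1/2"]) (use assms in \<open>auto intro!: summable_mehler\<close>)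
  have "(\<lambda>N. \<rho> * q ^ N) \<longlonglongrightarrow> \<rho> * 0"
    by (intro tendsto_mult tendsto_const LIMSEQ_power_zero) (use assms in auto)
  then have "(\<lambda>N. mehler q X Y (\<rho> * q ^ N)) \<longlonglongrightarrow> mehler q X Y 0"
    by (intro isCont_tendsto_compose[OF cont]) simp
  also have "mehler q X Y 0 = 1"
    unfolding mehler_def powser_zero by (rule mehler_coeff_small[OF assms(1)])
  finally have "(\<lambda>N. (\<Prod>k<2 * N. 1 - \<rho>\<^sup>2 * q ^ k) * mehler q X Y (\<rho> * q ^ N)) \<longlonglongrightarrow> q_poch_inf (\<rho>\<^sup>2) q * 1"
    unfolding q_poch_inf_def
    by (intro tendsto_mult filterlim_compose[OF prod_lessThan_LIMSEQ[OF convergent_prod_q_poch[OF assms(1)]]])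
       (auto intro!: filterlim_subseq simp: strict_mono_def)
  moreover have "(\<lambda>N. mehler q X Y \<rho> * (\<Prod>k<N. mehler_denom X Y (\<rho> * q ^ k))) \<longlonglongrightarrow> mehler q X Y \<rho> * (\<Prod>k. mehler_denom X Y (\<rho> * q ^ k))"
    using assms by (intro tendsto_mult tendsto_const prod_lessThan_LIMSEQ convergent_prod_mehler_denom) auto
  ultimately show ?thesis
    unfolding iter using LIMSEQ_unique by fastforce
qed

section \<open>The coefficients of the Chebyshev expansion\<close>

text \<open>The coefficient c_m of U_m, collecting the pairs with n + 2j = m.\<close>

definition cond_coeff :: "real \<Rightarrow> real \<Rightarrow> real \<Rightarrow> nat \<Rightarrow> real" where
  "cond_coeff q \<rho> Y m = (\<Sum>j\<le>m div 2. theta_coeff q j * gauss q (m - 2 * j) j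
     * (\<rho> ^ (m - 2 * j) * herm q (m - 2 * j) Y))"

text \<open>One absolutely convergent double series over (n, j), summed by rows and by n + 2j = m.
  The choice v = U gives the density; shifted polynomials k are inserted for the summation by
  parts.\<close>

lemma cond_coeff_sums:
  assumes "\<bar>q\<bar> < 1" "\<bar>Y\<bar> \<le> 2" "\<bar>\<rho>\<bar> < 1" and v: "\<And>m. \<bar>v m\<bar> \<le> c * (real m + 1)"
  obtains S where "(\<lambda>m. cond_coeff q \<rho> Y m * v m) sums S"
    "(\<lambda>n. \<rho> ^ n * herm q n Y * (\<Sum>j. theta_coeff q j * gauss q n j * v (n + 2 * j))) sums S"
proof -
  define g where "g n = \<rho> ^ n * herm q n Y" for n
  define f where "f = (\<lambda>(n, j). g n * (theta_coeff q j * gauss q n j * v (n + 2 * j)))"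
  obtain L where L: "L > 0" "\<And>n. \<bar>herm q n Y\<bar> \<le> L * (real n + 1)"
    using herm_abs_le[OF assms(1,2)] by metis
  obtain K where K: "K > 0" "\<And>v c n j. (\<And>m. \<bar>v m\<bar> \<le> c * (real m + 1)) \<Longrightarrow>
       \<bar>theta_coeff q j * gauss q n j * v (n + 2 * j)\<bar> \<le> c * K * (real n + 1) * (real (Suc j) * \<bar>q\<bar> ^ j)"
    using theta_U_term_bound[OF assms(1)] by metis
  have c: "c \<ge> 0" using v[of 0] by simp
  define A where "A n = L * c * K * ((real n + 1)\<^sup>2 * \<bar>\<rho>\<bar> ^ n)" for n
  define B where "B j = real (Suc j) * \<bar>q\<bar> ^ j" for j
  have AB: "\<bar>f (n, j)\<bar> \<le> A n * B j" for n j
  proof -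
    have "\<bar>g n\<bar> \<le> \<bar>\<rho>\<bar> ^ n * (L * (real n + 1))"
      unfolding g_def abs_mult power_abs by (intro mult_left_mono L) auto
    then have "\<bar>f (n, j)\<bar> \<le> \<bar>\<rho>\<bar> ^ n * (L * (real n + 1)) * (c * K * (real n + 1) * (real (Suc j) * \<bar>q\<bar> ^ j))"
      unfolding f_def prod.case abs_mult[of "g n"] using L K c v by (intro mult_mono K) auto
    then show ?thesis
      by (simp only: A_def B_def power2_eq_square mult_ac)
  qed
  have A0: "A n \<ge> 0" and B0: "B j \<ge> 0" for n j
    using L K c by (auto simp: A_def B_def)
  have "summable A"
    unfolding A_def by (intro summable_mult summable_Suc_square_power assms)
  then have As: "A summable_on UNIV"
    by (simp add: summable_on_UNIV_nonneg_real_iff A0)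
  have Bs: "(B has_sum (\<Sum>j. B j)) UNIV"
    by (intro sums_nonneg_imp_has_sum summable_sums B0) (unfold B_def, rule summable_Suc_power[OF assms(1)])
  have "(\<lambda>(n, j). A n * B j) summable_on Sigma UNIV (\<lambda>_. UNIV)"
  proof (rule summable_on_SigmaI)
    show "((\<lambda>j. case (n, j) of (n, j) \<Rightarrow> A n * B j) has_sum A n * (\<Sum>j. B j)) UNIV" for n
      using has_sum_cmult_right[OF Bs, of "A n"] by simp
    show "(\<lambda>n. A n * (\<Sum>j. B j)) summable_on UNIV"
      by (rule summable_on_cmult_left[OF As])
  qed (auto simp: A0 B0)
  then have "(\<lambda>p. norm (f p)) summable_on Sigma UNIV (\<lambda>_. UNIV)"
    by (rule summable_on_comparison_test) (use AB in auto)
  then have fS: "(f has_sum infsum f (Sigma UNIV (\<lambda>_. UNIV))) (Sigma UNIV (\<lambda>_. UNIV))"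
    by (rule has_sum_infsum[OF abs_summable_summable])
  define S where "S = infsum f (Sigma UNIV (\<lambda>_. UNIV))"
  have "((\<lambda>n. g n * (\<Sum>j. theta_coeff q j * gauss q n j * v (n + 2 * j))) has_sum S) UNIV"
  proof (rule has_sum_SigmaD[OF fS[folded S_def]])
    fix n
    have "summable (\<lambda>j. norm (theta_coeff q j * gauss q n j * v (n + 2 * j)))"
      unfolding real_norm_def by (rule summable_theta_U_term[OF assms(1) v])
    then have "((\<lambda>j. theta_coeff q j * gauss q n j * v (n + 2 * j)) has_sum
        (\<Sum>j. theta_coeff q j * gauss q n j * v (n + 2 * j))) UNIV"
      by (intro norm_summable_imp_has_sum summable_sums) (auto dest: summable_rabs_cancel)
    then show "((\<lambda>j. f (n, j)) has_sum g n * (\<Sum>j. theta_coeff q j * gauss q n j * v (n + 2 * j))) UNIV"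
      unfolding f_def prod.case by (rule has_sum_cmult_right)
  qed
  then have 1: "(\<lambda>n. \<rho> ^ n * herm q n Y * (\<Sum>j. theta_coeff q j * gauss q n j * v (n + 2 * j))) sums S"
    unfolding g_def by (rule has_sum_imp_sums)
  define h :: "nat \<times> nat \<Rightarrow> nat \<times> nat" where "h = (\<lambda>(m, j). (m - 2 * j, j))"
  have "bij_betw h (Sigma UNIV (\<lambda>m. {..m div 2})) (Sigma UNIV (\<lambda>_. UNIV))"
    by (rule bij_betw_byWitness[where f' = "\<lambda>(n, j). (n + 2 * j, j)"]) (auto simp: h_def)
  then have hS: "((\<lambda>x. f (h x)) has_sum S) (Sigma UNIV (\<lambda>m. {..m div 2}))"
    using fS by (simp only: has_sum_reindex_bij_betw S_def)
  have "((\<lambda>m. cond_coeff q \<rho> Y m * v m) has_sum S) UNIV"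
  proof (rule has_sum_SigmaD[OF hS])
    fix m
    have "(\<Sum>j\<le>m div 2. f (h (m, j))) = cond_coeff q \<rho> Y m * v m"
      unfolding cond_coeff_def sum_distrib_right
      by (intro sum.cong) (auto simp: f_def h_def g_def mult_ac)
    then show "((\<lambda>j. f (h (m, j))) has_sum cond_coeff q \<rho> Y m * v m) {..m div 2}"
      using has_sum_finite[of "{..m div 2}" "\<lambda>j. f (h (m, j))"] by simp
  qed
  then have "(\<lambda>m. cond_coeff q \<rho> Y m * v m) sums S"
    by (rule has_sum_imp_sums)
  with 1 show ?thesis using that by blast
qed

lemma cond_coeff_U_sums:
  assumes "\<bar>q\<bar> < 1" "\<bar>X\<bar> \<le> 2" "\<bar>Y\<bar> \<le> 2" "\<bar>\<rho>\<bar> < 1"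
  shows "(\<lambda>m. cond_coeff q \<rho> Y m * U m X) sums (theta_U q 0 X * mehler q X Y \<rho>)"
proof -
  obtain S where S: "(\<lambda>m. cond_coeff q \<rho> Y m * U m X) sums S"
    "(\<lambda>n. \<rho> ^ n * herm q n Y * theta_U q n X) sums S"
    unfolding theta_U_def
    by (rule cond_coeff_sums[OF assms(1,3,4), of "\<lambda>m. U m X" 1]) (use U_abs_le[OF assms(2)] in simp)
  have "\<rho> ^ n * herm q n Y * theta_U q n X = theta_U q 0 X * (mehler_coeff q X Y n * \<rho> ^ n)" for n
  proof -
    have "theta_U q n X = herm q n X * theta_U q 0 X / q_poch q n"
      using theta_U_eq_herm[OF assms(1,2), of n] q_poch_pos[OF assms(1), of n] by (simp add: field_simps)
    then show ?thesis by (simp add: mehler_coeff_def)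
  qed
  moreover have "(\<lambda>n. theta_U q 0 X * (mehler_coeff q X Y n * \<rho> ^ n)) sums (theta_U q 0 X * mehler q X Y \<rho>)"
    unfolding mehler_def by (intro sums_mult summable_sums summable_mehler assms)
  ultimately have "(\<lambda>n. \<rho> ^ n * herm q n Y * theta_U q n X) sums (theta_U q 0 X * mehler q X Y \<rho>)"
    by (simp only:)
  with S show ?thesis using sums_unique2 by blast
qed

text \<open>This is beta_(m+2) with j lowered by one, see \<open>beta_coeff_eq\<close>.\<close>

definition beta_sum :: "real \<Rightarrow> real \<Rightarrow> real \<Rightarrow> nat \<Rightarrow> real" where
  "beta_sum q \<rho> Y m = (\<Sum>j\<le>m div 2. theta_coeff q (Suc j) * q ^ (m - 2 * j) * gauss q (m - 2 * j) j
     * (\<rho> ^ (m - 2 * j) * herm q (m - 2 * j) Y))"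

text \<open>Provides a common range, so that sums belonging to m, m + 1 and m + 2 can be combined
  termwise.\<close>

lemma sum_guard:
  fixes f :: "nat \<Rightarrow> real"
  assumes "m \<le> M"
  shows "(\<Sum>j\<le>m div 2. f j) = (\<Sum>j\<le>M. if 2 * j \<le> m then f j else 0)"
proof -
  have "(\<Sum>j\<le>m div 2. f j) = (\<Sum>j\<in>{j \<in> {..M}. 2 * j \<le> m}. f j)"
    using assms by (intro sum.cong) auto
  then show ?thesis by (simp only: sum.inter_filter[OF finite_atMost])
qed

text \<open>With g_n = rho^n h_n(Y), the recurrence rho Y g_(n+1) = g_(n+2) + rho^2 (1 - q^(n+1))
  g_n splits the middle term in two. One half joins c_(m+2) by the q-Pascal rule (\<open>up\<close>)
  and gives \<open>beta_sum\<close>; the other joins rho^2 c_m by absorption (\<open>down\<close>)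
  and gives - rho^2 times the same sum.\<close>

lemma cond_coeff_recurrence:
  assumes "\<bar>q\<bar> < 1"
  shows "cond_coeff q \<rho> Y (m + 2) - \<rho> * Y * cond_coeff q \<rho> Y (m + 1) + \<rho>\<^sup>2 * cond_coeff q \<rho> Y m
    = (1 - \<rho>\<^sup>2) * beta_sum q \<rho> Y m"
proof -
  define g where "g n = \<rho> ^ n * herm q n Y" for n
  define A where "A m j = (if 2 * j \<le> m then theta_coeff q j * gauss q (m - 2 * j) j else 0)" for m j
  define B where "B j = (if 2 * j \<le> m then theta_coeff q (Suc j) * q ^ (m - 2 * j) * gauss q (m - 2 * j) j else 0)" for j
  have c: "cond_coeff q \<rho> Y n = (\<Sum>j\<le>M. A n j * g (n - 2 * j))" if "n \<le> M" for n M
    unfolding cond_coeff_def sum_guard[OF that] by (intro sum.cong) (auto simp: A_def g_def)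
  have b: "beta_sum q \<rho> Y m = (\<Sum>j\<le>m + 1. B j * g (m - 2 * j))"
    unfolding beta_sum_def by (subst sum_guard[of m "m + 1"]) (auto intro!: sum.cong simp: B_def g_def)
  have Yg: "\<rho> * Y * g (Suc n) = g (Suc (Suc n)) + \<rho>\<^sup>2 * ((1 - q ^ Suc n) * g n)" for n
    by (simp add: g_def power2_eq_square algebra_simps)
  have Yg0: "\<rho> * Y * g 0 = g 1" by (simp add: g_def)
  have mid: "\<rho> * Y * (A (m + 1) j * g (m + 1 - 2 * j))
     = A (m + 1) j * g (m + 2 - 2 * j) + \<rho>\<^sup>2 * (A (m + 1) j * (1 - q ^ (m + 1 - 2 * j)) * g (m - 2 * j))" for j
  proof -
    consider "2 * j \<le> m" | "2 * j = m + 1" | "2 * j > m + 1" by linarith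
    then show ?thesis
    proof cases
      case 1
      then have e: "m + 1 - 2 * j = Suc (m - 2 * j)" "m + 2 - 2 * j = Suc (Suc (m - 2 * j))" by auto
      have "\<rho> * Y * (A (m + 1) j * g (Suc (m - 2 * j))) = A (m + 1) j * (\<rho> * Y * g (Suc (m - 2 * j)))"
        by (simp only: mult_ac)
      then show ?thesis unfolding e Yg by (simp only: algebra_simps)
    next
      case 2
      \<comment> \<open>Here \<open>m - 2 * j\<close> truncates to 0, harmlessly: the factor 1 - q^0
        in front vanishes.\<close>
      then have e: "m + 1 - 2 * j = 0" "m + 2 - 2 * j = 1" by auto
      have "\<rho> * Y * (A (m + 1) j * g 0) = A (m + 1) j * (\<rho> * Y * g 0)"
        by (simp only: mult_ac)
      then show ?thesis unfolding e Yg0 by simp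
    next
      case 3
      then show ?thesis by (simp add: A_def)
    qed
  qed
  have up: "A (m + 2) (Suc j) - A (m + 1) (Suc j) = B j" for j
  proof -
    consider "2 * j < m" | "2 * j = m" | "2 * j > m" by linarith
    then show ?thesis
    proof cases
      case 1
      then obtain l where l: "m = 2 * j + Suc l" using less_iff_Suc_add by auto
      show ?thesis
        using gauss_pascal[OF assms, of l j] by (simp add: A_def B_def l algebra_simps)
    next
      case 2
      then show ?thesis using assms by (auto simp: A_def B_def)
    next
      case 3
      then show ?thesis by (simp add: A_def B_def)
    qed
  qed
  have down: "A m j - A (m + 1) j * (1 - q ^ (m + 1 - 2 * j)) = - B j" for j
  proof -
    consider "2 * j \<le> m" | "2 * j = m + 1" | "2 * j > m + 1" by linarith
    then show ?thesis
    proof cases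
      case 1
      then obtain l where l: "m = 2 * j + l" using le_iff_add by auto
      have "A m j - A (m + 1) j * (1 - q ^ (m + 1 - 2 * j))
         = theta_coeff q j * (gauss q l j - (1 - q ^ Suc l) * gauss q (Suc l) j)"
        by (simp add: A_def l Suc_diff_le algebra_simps)
      also have "\<dots> = - B j"
        unfolding gauss_absorb[OF assms] by (simp add: B_def l theta_coeff_Suc power_add algebra_simps)
      finally show ?thesis .
    qed (auto simp: A_def B_def)
  qed
  have "cond_coeff q \<rho> Y (m + 2) - \<rho> * Y * cond_coeff q \<rho> Y (m + 1) + \<rho>\<^sup>2 * cond_coeff q \<rho> Y m
    = (\<Sum>j\<le>m + 2. A (m + 2) j * g (m + 2 - 2 * j) - \<rho> * Y * (A (m + 1) j * g (m + 1 - 2 * j))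
         + \<rho>\<^sup>2 * (A m j * g (m - 2 * j)))"
    using c[of "m + 2" "m + 2"] c[of "m + 1" "m + 2"] c[of m "m + 2"] by (simp only: sum_distrib_left
        sum_subtractf sum.distrib)
  also have "\<dots> = (\<Sum>j\<le>m + 2. (A (m + 2) j - A (m + 1) j) * g (m + 2 - 2 * j)
      + \<rho>\<^sup>2 * ((A m j - A (m + 1) j * (1 - q ^ (m + 1 - 2 * j))) * g (m - 2 * j)))"
    unfolding mid by (intro sum.cong) (simp_all only: algebra_simps)
  also have "\<dots> = (\<Sum>j\<le>Suc (m + 1). (A (m + 2) j - A (m + 1) j) * g (m + 2 - 2 * j))
      - \<rho>\<^sup>2 * (\<Sum>j\<le>Suc (m + 1). B j * g (m - 2 * j))"
    unfolding down sum.distrib by (simp add: sum_distrib_left sum_negf algebra_simps)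
  \<comment> \<open>The term j = 0 cancels since \<open>A n 0 = 1\<close> for every n; the shift
    then turns m + 2 - 2(j+1) into m - 2j.\<close>
  also have "(\<Sum>j\<le>Suc (m + 1). (A (m + 2) j - A (m + 1) j) * g (m + 2 - 2 * j)) = beta_sum q \<rho> Y m"
    unfolding sum.atMost_Suc_shift up b using assms by (simp add: A_def)
  also have "(\<Sum>j\<le>Suc (m + 1). B j * g (m - 2 * j)) = beta_sum q \<rho> Y m"
    unfolding b by (simp add: B_def)
  finally show ?thesis by (simp add: algebra_simps)
qed

section \<open>The polynomials k and the densities\<close>

lemma theta_coeff_closed_form: "theta_coeff q j = (-1) ^ j * q ^ (j * (j + 1) div 2)"
proof (induction j)
  case (Suc j)
  have "Suc j * (Suc j + 1) = j * (j + 1) + Suc j * 2" by simp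
  then have "Suc j * (Suc j + 1) div 2 = j * (j + 1) div 2 + Suc j"
    by (simp only: div_mult_self1)
  then show ?case
    unfolding theta_coeff_Suc Suc by (simp add: power_add)
qed simp

lemma q_int_eq:
  assumes "q \<noteq> 1"
  shows "q_int q n = (1 - q ^ n) / (1 - q)"
  using assms one_diff_power_eq[of q n] by (simp add: q_int_def)

lemma q_fact_eq:
  assumes "q \<noteq> 1"
  shows "q_fact q n = q_poch q n / (1 - q) ^ n"
  by (simp add: q_fact_def q_poch_def q_int_eq[OF assms] prod_dividef)

lemma q_binom_eq_gauss:
  assumes "\<bar>q\<bar> < 1"
  shows "q_binom q (n + k) k = gauss q n k"
proof -
  have "q \<noteq> 1" "(1 - q) ^ (n + k) \<noteq> 0" using assms by auto
  then show ?thesis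
    by (simp add: q_binom_def gauss_def q_fact_eq power_add)
qed

lemma herm_eq_q_hermite:
  assumes "s\<^sup>2 = 1 - q"
  shows "s ^ n * q_hermite n y q = herm q n (y * s)"
proof (induction n rule: induct_nat_012)
  case (ge2 n)
  have "(1 - q) * q_int q (Suc n) = 1 - q ^ Suc n"
    by (simp only: q_int_def one_diff_power_eq)
  moreover have "s ^ Suc (Suc n) * q_hermite (Suc (Suc n)) y q
     = y * s * (s ^ Suc n * q_hermite (Suc n) y q) - s\<^sup>2 * q_int q (Suc n) * (s ^ n * q_hermite n y q)"
    by (simp add: algebra_simps power2_eq_square)
  ultimately show ?case unfolding ge2 assms by simp
qed simp_all

text \<open>Put n = m + 2, J = j + 1, l = n - 2J and s = sqrt(1-q). The factor (1-q)^(n/2-J) is s^l,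
  exactly the rescaling of H_l, and the exponent of q is l + J(J+1)/2, the second part belonging to
  the theta coefficient.\<close>

lemma beta_coeff_eq:
  assumes "\<bar>q\<bar> < 1"
  shows "beta_coeff (m + 2) y \<rho> q = beta_sum q \<rho> (y * sqrt (1 - q)) m"
proof -
  define s where "s = sqrt (1 - q)"
  have s2: "s\<^sup>2 = 1 - q" using assms by (simp add: s_def)
  have s: "s > 0" using assms by (simp add: s_def)
  have summand: "(-1) ^ Suc j * (1 - q) powr (real (m + 2) / 2 - real (Suc j))
        * q powi (int (m + 2) + (int (Suc j) * (int (Suc j) - 3)) div 2)
        * q_binom q (m + 2 - 1 - Suc j) (m + 2 - 2 * Suc j)
        * \<rho> ^ (m + 2 - 2 * Suc j) * q_hermite (m + 2 - 2 * Suc j) y q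
      = theta_coeff q (Suc j) * q ^ (m - 2 * j) * gauss q (m - 2 * j) j
        * (\<rho> ^ (m - 2 * j) * herm q (m - 2 * j) (y * s))" if "2 * j \<le> m" for j
  proof -
    define l where "l = m - 2 * j"
    have m: "m = l + 2 * j" using that by (simp add: l_def)
    have "real (m + 2) / 2 - real (Suc j) = real l / 2"
      by (simp add: m field_simps)
    then have "(1 - q) powr (real (m + 2) / 2 - real (Suc j)) = (s powr 2) powr (real l / 2)"
      using s by (simp only:) (simp add: s2)
    also have "\<dots> = s powr real l"
      by (simp only: powr_powr) simp
    also have "\<dots> = s ^ l"
      using s by (rule powr_realpow)
    finally have pw: "(1 - q) powr (real (m + 2) / 2 - real (Suc j)) = s ^ l" .
    \<comment> \<open>J(J-3) = J(J+1) - 4J, so the halving stays exact.\<close>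
    have "int (Suc j) * (int (Suc j) - 3) = int (Suc j * (Suc j + 1)) + (- 2 * int (Suc j)) * 2"
      by (simp add: algebra_simps)
    then have "(int (Suc j) * (int (Suc j) - 3)) div 2 = int (Suc j * (Suc j + 1) div 2) - 2 * int (Suc j)"
      by (simp only: div_mult_self1 zero_neq_numeral not_False_eq_True zdiv_int of_nat_numeral)
    then have "int (m + 2) + (int (Suc j) * (int (Suc j) - 3)) div 2 = int (l + Suc j * (Suc j + 1) div 2)"
      by (simp add: m)
    then have "q powi (int (m + 2) + (int (Suc j) * (int (Suc j) - 3)) div 2) = q ^ (l + Suc j * (Suc j + 1) div 2)"
      by (simp only: power_int_of_nat)
    then have e: "(-1) ^ Suc j * q powi (int (m + 2) + (int (Suc j) * (int (Suc j) - 3)) div 2)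
        = theta_coeff q (Suc j) * q ^ l"
      unfolding theta_coeff_closed_form by (simp only: power_add mult_ac)
    have b: "q_binom q (m + 2 - 1 - Suc j) (m + 2 - 2 * Suc j) = gauss q l j"
      using q_binom_eq_gauss[OF assms, of j l] by (simp add: m gauss_sym[of q l] add.commute)
    have i: "m + 2 - 2 * Suc j = l" by (simp add: l_def)
    show ?thesis
      unfolding pw b l_def[symmetric] herm_eq_q_hermite[OF s2, symmetric] e[symmetric] unfolding i
      by (simp only: mult_ac)
  qed
  have "(m + 2) div 2 = Suc (m div 2)" by simp
  then show ?thesis
    unfolding beta_coeff_def beta_sum_def s_def[symmetric]
    by (simp only: sum.atLeast1_atMost_eq[folded One_nat_def] lessThan_Suc_atMost) (intro sum.cong refl summand, simp)
qed

text \<open>Agrees with \<^const>\<open>k_poly\<close> from index 2 on. The first two values follow the convention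
  \<open>U\<^sub>-\<^sub>1 = 0\<close>, \<open>U\<^sub>-\<^sub>2 = -1\<close>, which makes the identity \<open>kpoly_combination\<close> hold from \<open>m = 0\<close> on.\<close>

fun kpoly :: "real \<Rightarrow> real \<Rightarrow> real \<Rightarrow> nat \<Rightarrow> real" where
  "kpoly X Y \<rho> 0 = 1 - \<rho>\<^sup>2"
| "kpoly X Y \<rho> (Suc 0) = X - \<rho> * Y"
| "kpoly X Y \<rho> (Suc (Suc n)) = U (Suc (Suc n)) X - \<rho> * Y * U (Suc n) X + \<rho>\<^sup>2 * U n X"

lemma k_poly_eq: "k_poly (n + 2) X Y \<rho> = kpoly X Y \<rho> (n + 2)"
  by (simp add: k_poly_def U_def)

text \<open>Let S shift the index of U. Then k_m = (1 - rho Y S^(-1) + rho^2 S^(-2)) U_m, and the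
  left side applies 1 - rho Y S + rho^2 S^2. Since S + S^(-1) acts as multiplication by X, the
  composition is multiplication by \<open>mehler_denom X Y \<rho>\<close>.\<close>

lemma kpoly_combination:
  "kpoly X Y \<rho> m - \<rho> * Y * kpoly X Y \<rho> (m + 1) + \<rho>\<^sup>2 * kpoly X Y \<rho> (m + 2) = mehler_denom X Y \<rho> * U m X"
proof (induction m rule: induct_nat_012)
  case 0
  show ?case by (simp add: mehler_denom_def numeral_eq_Suc) algebra
next
  case 1
  show ?case by (simp add: mehler_denom_def numeral_eq_Suc) algebra
next
  case (ge2 n)
  show ?case by (simp add: mehler_denom_def) algebra
qed

text \<open>The constant is 4 = 1 + 2 + 1, from the coefficients 1, |rho Y| <= 2 and rho^2 <=
  1.\<close>

lemma kpoly_abs_le: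
  assumes "\<bar>X\<bar> \<le> 2" "\<bar>Y\<bar> \<le> 2" "\<bar>\<rho>\<bar> \<le> 1"
  shows "\<bar>kpoly X Y \<rho> m\<bar> \<le> 4 * (real m + 1)"
proof -
  have a1: "\<bar>\<rho> * Y * u\<bar> \<le> 2 * \<bar>u\<bar>" for u
  proof -
    have "\<bar>\<rho>\<bar> * \<bar>Y\<bar> \<le> 1 * 2" using assms by (intro mult_mono) auto
    then show ?thesis unfolding abs_mult by (intro mult_right_mono) auto
  qed
  have r: "\<rho>\<^sup>2 \<le> 1" "\<rho>\<^sup>2 \<ge> 0" using assms by (simp_all add: abs_square_le_1)
  then have a2: "\<bar>\<rho>\<^sup>2 * u\<bar> \<le> \<bar>u\<bar>" for u
    unfolding abs_mult by (simp add: mult_left_le_one_le)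
  consider "m = 0" | "m = 1" | n where "m = Suc (Suc n)"
    by (metis One_nat_def not0_implies_Suc)
  then show ?thesis
  proof cases
    case 1
    have "\<bar>1 - \<rho>\<^sup>2\<bar> \<le> 4" using r by linarith
    then show ?thesis using 1 by simp
  next
    case 2
    then show ?thesis using a1[of 1] assms by simp
  next
    case 3
    have "\<bar>kpoly X Y \<rho> m\<bar> \<le> \<bar>U (Suc (Suc n)) X\<bar> + \<bar>\<rho> * Y * U (Suc n) X\<bar> + \<bar>\<rho>\<^sup>2 * U n X\<bar>"
      unfolding 3 kpoly.simps by linarith
    also have "\<dots> \<le> \<bar>U (Suc (Suc n)) X\<bar> + 2 * \<bar>U (Suc n) X\<bar> + \<bar>U n X\<bar>"
      by (intro add_mono a1 a2) simp
    also have "\<dots> \<le> 4 * (real m + 1)"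
      using U_abs_le[OF assms(1), of "Suc (Suc n)"] U_abs_le[OF assms(1), of "Suc n"]
        U_abs_le[OF assms(1), of n] unfolding 3 by simp
    finally show ?thesis .
  qed
qed

text \<open>Weighted by c_m and summed, \<open>kpoly_combination\<close> involves three series
  pairing c with k at offsets 0, 1 and 2. Reindexed to the common factor k_(n+2), they fit
  \<open>cond_coeff_recurrence\<close>; the terms left over add up to 1 - rho^2.\<close>

lemma beta_series:
  assumes "\<bar>q\<bar> < 1" "\<bar>X\<bar> \<le> 2" "\<bar>Y\<bar> \<le> 2" "\<bar>\<rho>\<bar> < 1"
  shows "(\<lambda>n. (1 - \<rho>\<^sup>2) * (beta_sum q \<rho> Y n * kpoly X Y \<rho> (n + 2)))
    sums (mehler_denom X Y \<rho> * (theta_U q 0 X * mehler q X Y \<rho>) - (1 - \<rho>\<^sup>2))"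
proof -
  define c k where "c = cond_coeff q \<rho> Y" and "k = kpoly X Y \<rho>"
  have kb: "\<bar>k m\<bar> \<le> 4 * (real m + 1)" for m
    unfolding k_def using kpoly_abs_le assms by auto
  \<comment> \<open>Separate convergence lets each of the three series be shifted by its own
    offset.\<close>
  have summable: "summable (\<lambda>m. c m * v m)" if v: "\<And>m. \<bar>v m\<bar> \<le> d * (real m + 1)" for v d
  proof -
    obtain S where "(\<lambda>m. c m * v m) sums S"
      unfolding c_def by (rule cond_coeff_sums[OF assms(1,3,4) v])
    then show ?thesis by (rule sums_summable)
  qed
  have "\<bar>k (m + 1)\<bar> \<le> 8 * (real m + 1)" "\<bar>k (m + 2)\<bar> \<le> 12 * (real m + 1)" for m
    using kb[of "m + 1"] kb[of "m + 2"] by simp_all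
  note bounds = kb this
  obtain C0 C1 C2 where C0: "(\<lambda>m. c m * k m) sums C0"
    and C1: "(\<lambda>m. c m * k (m + 1)) sums C1" and C2: "(\<lambda>m. c m * k (m + 2)) sums C2"
    using summable[OF bounds(1)] summable[OF bounds(2)] summable[OF bounds(3)]
    unfolding summable_def by blast
  have "(\<lambda>m. c m * k m - \<rho> * Y * (c m * k (m + 1)) + \<rho>\<^sup>2 * (c m * k (m + 2))) sums (C0 - \<rho> * Y * C1 + \<rho>\<^sup>2 * C2)"
    by (intro sums_add sums_diff sums_mult C0 C1 C2)
  moreover have "c m * k m - \<rho> * Y * (c m * k (m + 1)) + \<rho>\<^sup>2 * (c m * k (m + 2)) = mehler_denom X Y \<rho> * (c m * U m X)" for m
  proof -
    have "c m * k m - \<rho> * Y * (c m * k (m + 1)) + \<rho>\<^sup>2 * (c m * k (m + 2))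
       = c m * (k m - \<rho> * Y * k (m + 1) + \<rho>\<^sup>2 * k (m + 2))"
      by (simp only: algebra_simps)
    then show ?thesis unfolding k_def kpoly_combination by (simp only: mult_ac)
  qed
  ultimately have "(\<lambda>m. mehler_denom X Y \<rho> * (c m * U m X)) sums (C0 - \<rho> * Y * C1 + \<rho>\<^sup>2 * C2)"
    by (simp only:)
  moreover have "(\<lambda>m. mehler_denom X Y \<rho> * (c m * U m X)) sums (mehler_denom X Y \<rho> * (theta_U q 0 X * mehler q X Y \<rho>))"
    unfolding c_def by (intro sums_mult cond_coeff_U_sums assms)
  ultimately have total: "C0 - \<rho> * Y * C1 + \<rho>\<^sup>2 * C2 = mehler_denom X Y \<rho> * (theta_U q 0 X * mehler q X Y \<rho>)"
    by (rule sums_unique2)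
  have init: "c 0 = 1" "c 1 = \<rho> * Y" "k 0 = 1 - \<rho>\<^sup>2" "k 1 = X - \<rho> * Y"
    using assms by (simp_all add: c_def k_def cond_coeff_def)
  have "(\<lambda>n. c (n + 2) * k (n + 2) - \<rho> * Y * (c (n + 1) * k (n + 1 + 1)) + \<rho>\<^sup>2 * (c n * k (n + 2)))
    sums ((C0 - (\<Sum>m<2. c m * k m)) - \<rho> * Y * (C1 - (\<Sum>m<1. c m * k (m + 1))) + \<rho>\<^sup>2 * C2)"
    by (intro sums_add sums_diff sums_mult sums_split_initial_segment[OF C0] sums_split_initial_segment[OF C1] C2)
  moreover have "c (n + 2) * k (n + 2) - \<rho> * Y * (c (n + 1) * k (n + 1 + 1)) + \<rho>\<^sup>2 * (c n * k (n + 2))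
     = (1 - \<rho>\<^sup>2) * (beta_sum q \<rho> Y n * k (n + 2))" for n
  proof -
    have "c (n + 2) * k (n + 2) - \<rho> * Y * (c (n + 1) * k (n + 1 + 1)) + \<rho>\<^sup>2 * (c n * k (n + 2))
      = (c (n + 2) - \<rho> * Y * c (n + 1) + \<rho>\<^sup>2 * c n) * k (n + 2)"
      by (simp add: algebra_simps)
    then show ?thesis
      unfolding c_def cond_coeff_recurrence[OF assms(1)] by (simp only: mult_ac)
  qed
  moreover have "(C0 - (\<Sum>m<2. c m * k m)) - \<rho> * Y * (C1 - (\<Sum>m<1. c m * k (m + 1))) + \<rho>\<^sup>2 * C2
     = mehler_denom X Y \<rho> * (theta_U q 0 X * mehler q X Y \<rho>) - (1 - \<rho>\<^sup>2)"
  proof -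
    have sums: "(\<Sum>m<2. c m * k m) = c 0 * k 0 + c 1 * k 1" "(\<Sum>m<1. c m * k (m + 1)) = c 0 * k 1"
      by (simp_all add: numeral_eq_Suc)
    show ?thesis
      unfolding total[symmetric] sums init by (simp add: algebra_simps power2_eq_square)
  qed
  ultimately show ?thesis by (simp only: k_def)
qed

lemma f_CN_eq:
  fixes x y q \<rho> :: real
  defines "X \<equiv> x * sqrt (1 - q)" and "Y \<equiv> y * sqrt (1 - q)"
  assumes "\<bar>q\<bar> < 1" "\<bar>X\<bar> \<le> 2" "\<bar>Y\<bar> \<le> 2" "\<bar>\<rho>\<bar> < 1"
  shows "f_CN x y \<rho> q = sqrt (1 - q) * sqrt (4 - X\<^sup>2) / (2 * pi) * (theta_U q 0 X * mehler q X Y \<rho>)"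
    and "f_K x y \<rho> q = (1 - \<rho>\<^sup>2) * sqrt (1 - q) * sqrt (4 - X\<^sup>2) / (2 * pi * mehler_denom X Y \<rho>)"
proof -
  have X2: "X\<^sup>2 = (1 - q) * x\<^sup>2" and Y2: "Y\<^sup>2 = (1 - q) * y\<^sup>2" and XY: "X * Y = (1 - q) * x * y"
    using assms(3) by (simp_all add: X_def Y_def power_mult_distrib)
  have mehler_denom: "mehler_denom X Y (\<rho> * t) = (1 - \<rho>\<^sup>2 * t\<^sup>2)\<^sup>2 - (1 - q) * \<rho> * t * (1 + \<rho>\<^sup>2 * t\<^sup>2) * x * y
          + (1 - q) * \<rho>\<^sup>2 * (x\<^sup>2 + y\<^sup>2) * t\<^sup>2" for t
    unfolding mehler_denom_def mult.assoc[of _ X Y] XY X2 Y2 by algebra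
  show "f_K x y \<rho> q = (1 - \<rho>\<^sup>2) * sqrt (1 - q) * sqrt (4 - X\<^sup>2) / (2 * pi * mehler_denom X Y \<rho>)"
    using mehler_denom[of 1] by (simp add: f_K_def X2 mult_ac)
  show "f_CN x y \<rho> q = sqrt (1 - q) * sqrt (4 - X\<^sup>2) / (2 * pi) * (theta_U q 0 X * mehler q X Y \<rho>)"
  proof (cases "X\<^sup>2 = 4")
    \<comment> \<open>Both sides are 0: the prefactor of \<open>f_CN\<close> is a division by
      \<open>sqrt 0\<close>.\<close>
    case True
    then show ?thesis by (simp add: f_CN_def X2)
  next
    case False
    have X4: "4 - X\<^sup>2 > 0"
      using False assms(4) abs_le_square_iff[of X 2] by simp
    have tf: "convergent_prod (\<lambda>k. theta_factor X (q ^ k))"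
      by (rule convergent_prod_theta_factor[OF assms(3)])
    have cW: "convergent_prod (\<lambda>k. mehler_denom X Y (\<rho> * q ^ k))"
      using assms by (intro convergent_prod_mehler_denom) auto
    have Wnz: "(\<Prod>k. mehler_denom X Y (\<rho> * q ^ k)) \<noteq> 0"
    proof (rule prodinf_nonzero[OF cW])
      fix k
      have "\<bar>\<rho> * q ^ k\<bar> \<le> \<bar>\<rho>\<bar>"
        using assms(3) by (simp add: abs_mult power_abs mult_left_le power_le_one)
      then show "mehler_denom X Y (\<rho> * q ^ k) \<noteq> 0"
        using mehler_denom_pos[OF assms(4,5), of "\<rho> * q ^ k"] assms(6) by simp
    qed
    have "f_CN x y \<rho> q = sqrt (1 - q) * q_poch_inf (\<rho>\<^sup>2) q * q_poch_inf q q / (2 * pi * sqrt (4 - X\<^sup>2)) *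
       (\<Prod>k. theta_factor X (q ^ k) / mehler_denom X Y (\<rho> * q ^ k))"
      unfolding f_CN_def mehler_denom theta_factor_def X2 by (simp only: power_even_eq)
    also have "(\<Prod>k. theta_factor X (q ^ k) / mehler_denom X Y (\<rho> * q ^ k))
        = (\<Prod>k. theta_factor X (q ^ k)) / (\<Prod>k. mehler_denom X Y (\<rho> * q ^ k))"
      by (rule prodinf_divide[OF tf cW, symmetric])
    also have "(\<Prod>k. theta_factor X (q ^ k)) = (4 - X\<^sup>2) * (\<Prod>k. theta_factor X (q ^ Suc k))"
      using prodinf_split_head[OF tf] X4 by (simp add: theta_factor_def)
    finally have f: "f_CN x y \<rho> q = sqrt (1 - q) * q_poch_inf (\<rho>\<^sup>2) q * q_poch_inf q q / (2 * pi * sqrt (4 - X\<^sup>2)) *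
       ((4 - X\<^sup>2) * (\<Prod>k. theta_factor X (q ^ Suc k)) / (\<Prod>k. mehler_denom X Y (\<rho> * q ^ k)))" .
    \<comment> \<open>The split-off factor 4 - X^2 = R R against 1 / R leaves the R of the
      semicircle.\<close>
    define R where "R = sqrt (4 - X\<^sup>2)"
    have R: "4 - X\<^sup>2 = R * R" "R \<noteq> 0" "sqrt (R * R) = R" using X4 by (auto simp: R_def)
    show ?thesis
      unfolding f theta_U_0_eq(1)[OF assms(3,4)] mehler_formula[OF assms(3-6), symmetric] R
      using Wnz R(2) by simp
  qed
qed

text \<open>Convergence is asserted separately because \<open>suminf\<close> has a value for
  divergent series too. The shift n + 2 starts the sum at 2 and keeps the subtractions in
  \<open>k_poly\<close> exact.\<close>

theorem mainTheorem6:
  fixes q \<rho> x y :: real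
  assumes "q \<in> {-1<..<1}"
    and "0 < \<bar>\<rho>\<bar>" and "\<bar>\<rho>\<bar> < 1"
    and "x \<in> {- (2 / sqrt (1 - q))..2 / sqrt (1 - q)}"
    and "y \<in> {- (2 / sqrt (1 - q))..2 / sqrt (1 - q)}"
  shows "summable (\<lambda>n. beta_coeff (n + 2) y \<rho> q
             * k_poly (n + 2) (x * sqrt (1 - q)) (y * sqrt (1 - q)) \<rho>)
    \<and> f_CN x y \<rho> q = f_K x y \<rho> q *
        (1 + (\<Sum>n. beta_coeff (n + 2) y \<rho> q
             * k_poly (n + 2) (x * sqrt (1 - q)) (y * sqrt (1 - q)) \<rho>))"
proof -
  define X Y where "X = x * sqrt (1 - q)" and "Y = y * sqrt (1 - q)"
  have q: "\<bar>q\<bar> < 1" using assms(1) by auto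
  have X: "\<bar>X\<bar> \<le> 2" and Y: "\<bar>Y\<bar> \<le> 2"
    using assms(4,5) q by (simp_all add: X_def Y_def abs_le_iff field_simps)
  have r: "1 - \<rho>\<^sup>2 \<noteq> 0"
    using assms(3) abs_square_less_1[of \<rho>] by simp
  define S where "S = mehler_denom X Y \<rho> * (theta_U q 0 X * mehler q X Y \<rho>)"
  have summand: "beta_coeff (n + 2) y \<rho> q * k_poly (n + 2) X Y \<rho> = beta_sum q \<rho> Y n * kpoly X Y \<rho> (n + 2)" for n
    by (simp only: beta_coeff_eq[OF q] k_poly_eq Y_def)
  have "(\<lambda>n. beta_coeff (n + 2) y \<rho> q * k_poly (n + 2) X Y \<rho>) sums ((S - (1 - \<rho>\<^sup>2)) / (1 - \<rho>\<^sup>2))"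
    using sums_divide[OF beta_series[OF q X Y assms(3)], of "1 - \<rho>\<^sup>2"] r
    unfolding summand S_def by simp
  moreover have "f_CN x y \<rho> q = f_K x y \<rho> q * (1 + (S - (1 - \<rho>\<^sup>2)) / (1 - \<rho>\<^sup>2))"
  proof -
    have "1 + (S - (1 - \<rho>\<^sup>2)) / (1 - \<rho>\<^sup>2) = S / (1 - \<rho>\<^sup>2)"
      using r by (simp add: field_simps)
    then show ?thesis
      using f_CN_eq[of q x y \<rho>, folded X_def Y_def, OF q X Y assms(3)] r mehler_denom_pos[OF X Y assms(3)]
      by (simp add: S_def)
  qed
  ultimately show ?thesis
    unfolding X_def[symmetric] Y_def[symmetric] by (auto simp: sums_iff)
qed

end
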